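(* Let $n\ge2$, $p\in[2,\infty)$ and let $f:\mathbb{B}^n\to\mathbb{R}$ be a hyperbolic harmonic function in $\mathbb{B}^n$. If $$M_p(r,\nabla f)=O\left(\frac1{1-r}\right)\quad\text{as } r\to1^-,$$ then $$M_p(r,f)=O\left(\left(\log\frac1{1-r}\right)^{\frac12}\right)\quad\text{as } r\to1^-.$$
   Context: $\mathbb{B}^n$ and $\mathbb{S}^{n-1}$ are the open unit ball and unit sphere of $\mathbb{R}^n$; $\sigma$ is the normalized surface measure on $\mathbb{S}^{n-1}$. For $f$ on $\mathbb{B}^n$ with values in some $\mathbb{R}^\nu$ and measurable, $M_p(r,f)=\left(\int_{\mathbb{S}^{n-1}}|f(r\zeta)|^p\,d\sigma(\zeta)\right)^{1/p}$. A function $f\in C^2(\mathbb{B}^n)$ is hyperbolic harmonic if $\Delta_hf=0$ in $\mathbb{B}^n$, where $$\Delta_hf(x)=(1-|x|^2)\left[(1-|x|^2)\Delta f(x)+2(n-2)\langle\nabla f(x),x\rangle\right]$$ and $\Delta$ is the Euclidean Laplacian. *)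

theory Defs
  imports "HOL-Analysis.Analysis" "HOL-Library.Landau_Symbols"
begin

text \<open>Functions on the open unit ball are total functions; only their values on
  \<^term>\<open>ball 0 1\<close> matter below.\<close>

definition partial :: "'a::euclidean_space \<Rightarrow> ('a \<Rightarrow> real) \<Rightarrow> 'a \<Rightarrow> real" where
  "partial b f x = frechet_derivative f (at x) b"

definition grad :: "('a::euclidean_space \<Rightarrow> real) \<Rightarrow> 'a \<Rightarrow> 'a" where
  "grad f x = (\<Sum>b\<in>Basis. partial b f x *\<^sub>R b)"

definition laplacian :: "('a::euclidean_space \<Rightarrow> real) \<Rightarrow> 'a \<Rightarrow> real" where
  "laplacian f x = (\<Sum>b\<in>Basis. partial b (partial b f) x)"

text \<open>The sets of interest are open. \<^const>\<open>frechet_derivative\<close> is unspecified where no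
  derivative exists, so differentiability is required explicitly.\<close>

definition C1_on :: "'a::euclidean_space set \<Rightarrow> ('a \<Rightarrow> real) \<Rightarrow> bool" where
  "C1_on S f \<longleftrightarrow> (\<forall>x\<in>S. f differentiable (at x)) \<and> (\<forall>b\<in>Basis. continuous_on S (partial b f))"

definition C2_on :: "'a::euclidean_space set \<Rightarrow> ('a \<Rightarrow> real) \<Rightarrow> bool" where
  "C2_on S f \<longleftrightarrow> C1_on S f \<and> (\<forall>b\<in>Basis. C1_on S (partial b f))"

definition hyperbolic_laplacian :: "('a::euclidean_space \<Rightarrow> real) \<Rightarrow> 'a \<Rightarrow> real" where
  "hyperbolic_laplacian f x =
     (1 - (norm x)\<^sup>2) * ((1 - (norm x)\<^sup>2) * laplacian f x
       + 2 * (real DIM('a) - 2) * (grad f x \<bullet> x))"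

definition hyperbolic_harmonic :: "('a::euclidean_space \<Rightarrow> real) \<Rightarrow> bool" where
  "hyperbolic_harmonic f \<longleftrightarrow>
     C2_on (ball 0 1) f \<and> (\<forall>x\<in>ball 0 1. hyperbolic_laplacian f x = 0)"

text \<open>Normalized surface measure on the unit sphere, as the cone measure of polar
  coordinates: a Borel set \<open>A\<close> gets the Lebesgue measure of the part of the unit ball
  whose radial projection lies in \<open>A\<close>, divided by the volume of the ball. Here
  \<^term>\<open>sgn x\<close> is \<^term>\<open>x /\<^sub>R norm x\<close>; the restriction discards the value
  \<^term>\<open>sgn 0 = 0\<close>, which carries no mass.\<close>

definition sphere_measure :: "'a::euclidean_space measure" where
  "sphere_measure =
     restrict_space (distr (uniform_measure lborel (ball 0 1)) borel sgn) (sphere 0 1)"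

lemma space_sphere_measure: "space sphere_measure = sphere (0::'a::euclidean_space) 1"
  by (simp add: sphere_measure_def space_restrict_space)

lemma emeasure_sphere_measure:
  fixes A :: "'a::euclidean_space set"
  assumes "A \<in> sets borel" "A \<subseteq> sphere 0 1"
  shows "emeasure sphere_measure A =
    emeasure lborel {x \<in> ball 0 1. sgn x \<in> A} / emeasure lborel (ball (0::'a) 1)"
proof -
  have m: "sgn \<in> borel_measurable (borel :: 'a measure)"
    unfolding sgn_div_norm[abs_def] by measurable
  have sb: "sgn -` A \<in> sets (borel :: 'a measure)"
    using measurable_sets[OF m assms(1)] by simp
  have eq: "ball 0 1 \<inter> sgn -` A = {x \<in> ball 0 1. sgn x \<in> A}" by auto
  have "emeasure sphere_measure A
      = emeasure (distr (uniform_measure lborel (ball (0::'a) 1)) borel sgn) A"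
    unfolding sphere_measure_def
    by (rule emeasure_restrict_space) (use assms in auto)
  also have "\<dots> = emeasure (uniform_measure lborel (ball (0::'a) 1)) (sgn -` A)"
    using m assms(1) by (subst emeasure_distr) auto
  also have "\<dots> = emeasure lborel (ball (0::'a) 1 \<inter> sgn -` A) / emeasure lborel (ball (0::'a) 1)"
    using sb by (subst emeasure_uniform_measure) auto
  finally show ?thesis by (simp only: eq)
qed

lemma emeasure_sphere_measure_space:
  "emeasure sphere_measure (sphere (0::'a::euclidean_space) 1) = 1"
proof -
  have "{x \<in> ball 0 1. sgn x \<in> sphere (0::'a) 1} = ball 0 1 - {0}"
    by (auto simp: norm_sgn)
  moreover have "emeasure lborel (ball (0::'a) 1 - {0}) = emeasure lborel (ball (0::'a) 1)"
    by (rule emeasure_Diff_null_set) auto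
  moreover have "emeasure lborel (ball (0::'a) 1) \<noteq> 0"
    using content_ball_pos[of 1 "0::'a"] by (auto simp: measure_def)
  moreover have "emeasure lborel (ball (0::'a) 1) \<noteq> \<infinity>"
    using emeasure_lborel_ball_finite[of "0::'a" 1] by auto
  ultimately show ?thesis
    by (simp add: emeasure_sphere_measure ennreal_divide_self less_top)
qed

text \<open>\<open>M\<^sub>p(r, f)\<close>. The Bochner integral is \<open>0\<close> for non-integrable functions, so this is
  the usual mean only where the integral is finite, e.g. for \<open>f\<close> continuous on the ball and
  \<open>0 \<le> r < 1\<close>.\<close>

definition integral_mean ::
  "real \<Rightarrow> real \<Rightarrow> ('a::euclidean_space \<Rightarrow> 'b::euclidean_space) \<Rightarrow> real" where
  "integral_mean p r f =
     (\<integral>\<zeta>. norm (f (r *\<^sub>R \<zeta>)) powr p \<partial>sphere_measure) powr (1 / p)"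

end

theory Submission
  imports Defs "HOL-Probability.Probability_Measure"
begin

text \<open>Let \<open>u = (1 + f\<^sup>2) powr (p / 2)\<close>, a smooth substitute for \<open>|f| powr p\<close> that stays away from \<open>0\<close>,
  let \<open>\<phi> r\<close> be its mean over the sphere of radius \<open>r\<close>, and let \<open>n\<close> be the dimension. Then
  \<open>\<phi>' r\<close> is the flux of \<open>\<nabla>u\<close>, and by the divergence theorem
  \<open>r\<^sup>n\<^sup>-\<^sup>1 \<phi>' r\<close> is the integral of \<open>t\<^sup>n\<^sup>-\<^sup>1\<close> times the spherical mean of \<open>\<Delta>u\<close>. Hyperbolic harmonicity
  turns this into a linear differential equation for \<open>\<phi>'\<close>, solved with the integrating factor
  \<open>(1 - r\<^sup>2)\<^sup>2\<^sup>-\<^sup>n\<close>, whose source term is at most a constant times \<open>\<phi> powr (1 - 2 / p) / (1 - r)\<^sup>2\<close> by Hoelder's inequality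
  and the bound on \<open>\<nabla>f\<close>. Hence \<open>(\<phi> powr (2 / p))' \<le> C / (1 - r)\<close>.\<close>

subsection \<open>Polar coordinates in the unit ball\<close>

text \<open>The powers of \<open>1 - r\<close> fit exactly. Source times integrating factor has size
  \<open>(1 - t) powr (- n)\<close>; integrating gives \<open>(1 - r) powr (1 - n)\<close>, and
  removing the factor leaves one power,
  \<open>\<phi>' \<le> C * \<phi> powr (1 - 2 / p) / (1 - r)\<close>. This Bernoulli-type inequality
  becomes linear for \<open>\<phi> powr (2 / p)\<close>, which dominates the square of the mean of
  \<open>f\<close>: hence a logarithm and then its square root. To integrate, the power of
  \<open>\<phi>\<close> has to leave the integral, so \<open>\<phi>\<close> must be increasing; that
  follows from the nonnegative source, that is from the convexity of
  \<open>(1 + y\<^sup>2) powr (p / 2)\<close>. The flux identity is reached without integrating over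
  a ball with a sharp boundary: the field is multiplied by a C1 radial cutoff, only translation
  invariance and polar coordinates are used, and the cutoff is removed afterwards by varying its
  radius.\<close>

abbreviation uniform_ball :: "'a::euclidean_space measure" where
  "uniform_ball \<equiv> uniform_measure lborel (ball 0 1)"

text \<open>The law of \<open>norm x\<close> for \<open>x\<close> uniform in the unit ball of
  dimension \<open>n\<close>: the ball of radius \<open>t\<close> carries the fraction
  \<open>t ^ n\<close> of the volume, and the density is the derivative of that.\<close>

definition radial_measure :: "nat \<Rightarrow> real measure" where
  "radial_measure n = density lborel (\<lambda>t. ennreal (indicator {0..1} t * (real n * t ^ (n - 1))))"

lemma borel_measurable_sgn[measurable]:
  "sgn \<in> borel_measurable (borel :: 'a::euclidean_space measure)"
  unfolding sgn_div_norm[abs_def] by measurable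

lemma emeasure_unit_ball:
  "emeasure lborel (ball (0::'a::euclidean_space) 1) \<noteq> 0"
  "emeasure lborel (ball (0::'a::euclidean_space) 1) \<noteq> \<infinity>"
  using content_ball_pos[of 1 "0::'a"] emeasure_lborel_ball_finite[of "0::'a" 1]
  by (auto simp: measure_def)

lemma prob_space_uniform_ball: "prob_space (uniform_ball :: 'a::euclidean_space measure)"
  using emeasure_unit_ball by (rule prob_space_uniform_measure)

lemma emeasure_radial_measure_greaterThan:
  assumes "n > 0"
  shows "emeasure (radial_measure n) {t<..} = ennreal (1 - (min 1 (max 0 t)) ^ n)"
proof -
  define s where "s = min 1 (max 0 t)"
  have s: "0 \<le> s" "s \<le> 1" by (auto simp: s_def)
  have "emeasure (radial_measure n) {t<..} = (\<integral>\<^sup>+u. ennreal (indicator {0..1} u * (real n * u ^ (n - 1))) * indicator {t<..} u \<partial>lborel)"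
    unfolding radial_measure_def by (subst emeasure_density) auto
  also have "\<dots> = (\<integral>\<^sup>+u. ennreal (real n * u ^ (n - 1)) * indicator {s..1} u \<partial>lborel)"
  proof (rule nn_integral_cong_AE)
    have "AE u in lborel. u \<noteq> t" by (rule AE_lborel_singleton)
    moreover have "AE u in lborel. u \<noteq> 1" by (rule AE_lborel_singleton)
    ultimately show "AE u in lborel. ennreal (indicator {0..1} u * (real n * u ^ (n - 1))) * indicator {t<..} u
        = ennreal (real n * u ^ (n - 1)) * indicator {s..1} u"
      by eventually_elim (auto simp: s_def indicator_def min_def max_def split: if_splits)
  qed
  also have "\<dots> = ennreal (1 ^ n - s ^ n)"
    using s assms by (intro nn_integral_FTC_Icc) (auto intro!: derivative_eq_intros)
  finally show ?thesis by (simp add: s_def)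
qed

text \<open>Dilation by \<open>t\<close> preserves \<open>sgn\<close> and multiplies volume by
  \<open>t ^ DIM('a)\<close>. Passing from the closed to the open unit ball costs only the
  negligible sphere.\<close>

lemma emeasure_lborel_cone:
  fixes B :: "'a::euclidean_space set"
  assumes [measurable]: "B \<in> sets borel" and "0 < t"
  shows "emeasure lborel {x. norm x \<le> t \<and> sgn x \<in> B} =
    ennreal (t ^ DIM('a)) * emeasure lborel {x. norm x < 1 \<and> sgn x \<in> B}"
proof -
  have "emeasure lborel {x. norm x \<le> t \<and> sgn x \<in> B} =
      emeasure (density (distr lborel borel (\<lambda>x. 0 + t *\<^sub>R x)) (\<lambda>_. ennreal (\<bar>t\<bar> ^ DIM('a)))) {x. norm x \<le> t \<and> sgn x \<in> B}"
    using lborel_affine[of t "0::'a"] assms by simp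
  also have "\<dots> = ennreal (t ^ DIM('a)) * emeasure lborel ((\<lambda>x. t *\<^sub>R x) -` {x. norm x \<le> t \<and> sgn x \<in> B})"
    using assms by (simp add: emeasure_density nn_integral_cmult_indicator emeasure_distr)
  also have "(\<lambda>x. t *\<^sub>R x) -` {x. norm x \<le> t \<and> sgn x \<in> B} = {x. norm x \<le> 1 \<and> sgn x \<in> B}"
    using assms(2) by (auto simp: sgn_scaleR)
  also have "emeasure lborel \<dots> = emeasure lborel {x. norm x < 1 \<and> sgn x \<in> B}"
  proof (rule emeasure_eq_AE)
    have "negligible (sphere (0::'a) 1)" by (rule negligible_sphere)
    then have "AE x in lborel. x \<notin> sphere (0::'a) 1"
      by (intro AE_not_in) (auto simp: null_sets_def negligible_iff_emeasure0)
    then show "AE x in lborel. x \<in> {x. norm x \<le> 1 \<and> sgn x \<in> B} \<longleftrightarrow> x \<in> {x. norm x < 1 \<and> sgn x \<in> B}"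
      by eventually_elim auto
  qed measurable
  finally show ?thesis .
qed

lemma emeasure_uniform_ball_greater:
  fixes B :: "'a::euclidean_space set"
  assumes [measurable]: "B \<in> sets borel"
  shows "emeasure uniform_ball {x. t < norm x \<and> sgn x \<in> B} =
    ennreal (1 - (min 1 (max 0 t)) ^ DIM('a)) * emeasure uniform_ball (sgn -` B)"
proof -
  interpret U: prob_space "uniform_ball :: 'a measure" by (rule prob_space_uniform_ball)
  have sB: "sgn -` B \<in> sets borel" using measurable_sets[OF borel_measurable_sgn assms] by simp
  consider "t \<ge> 1" | "t < 0" | "0 \<le> t" "t < 1" by linarith
  then show ?thesis
  proof cases
    case 1
    then have "ball 0 1 \<inter> {x. t < norm x \<and> sgn x \<in> B} = {}" by auto
    then have "emeasure uniform_ball {x. t < norm x \<and> sgn x \<in> B} = 0"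
      by (subst emeasure_uniform_measure) auto
    then show ?thesis using 1 by simp
  next
    case 2
    then have "{x. t < norm x \<and> sgn x \<in> B} = sgn -` B" by (auto intro: less_le_trans)
    then show ?thesis using 2 by (simp add: zero_power del: emeasure_uniform_measure)
  next
    case 3
    define V where "V = {x. norm x \<le> t \<and> sgn x \<in> B}"
    have [measurable]: "V \<in> sets borel" unfolding V_def by measurable
    have V: "emeasure uniform_ball V = ennreal (t ^ DIM('a)) * emeasure uniform_ball (sgn -` B)"
    proof (cases "t = 0")
      case True
      then have "V \<subseteq> {0}" by (auto simp: V_def)
      then have "emeasure lborel V = 0"
        by (metis emeasure_lborel_countable countable_empty countable_insert countable_subset)
      then have "emeasure lborel (ball 0 1 \<inter> V) = 0"
        by (metis emeasure_mono inf_le2 le_zero_eq sets_lborel \<open>V \<in> sets borel\<close>)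
      then show ?thesis using True by (subst emeasure_uniform_measure) auto
    next
      case False
      have "emeasure uniform_ball V = emeasure lborel (ball 0 1 \<inter> V) / emeasure lborel (ball (0::'a) 1)"
        by (subst emeasure_uniform_measure) auto
      also have "ball 0 1 \<inter> V = V" using 3 by (auto simp: V_def)
      also have "emeasure lborel V = ennreal (t ^ DIM('a)) * emeasure lborel {x. norm x < 1 \<and> sgn x \<in> B}"
        unfolding V_def using False 3 by (intro emeasure_lborel_cone) auto
      also have "{x. norm x < 1 \<and> sgn x \<in> B} = ball 0 1 \<inter> sgn -` B" by auto
      also have "ennreal (t ^ DIM('a)) * emeasure lborel (ball 0 1 \<inter> sgn -` B) / emeasure lborel (ball (0::'a) 1)
          = ennreal (t ^ DIM('a)) * emeasure uniform_ball (sgn -` B)"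
        using sB by (subst emeasure_uniform_measure) (auto simp: ennreal_times_divide)
      finally show ?thesis .
    qed
    have eq: "{x. t < norm x \<and> sgn x \<in> B} = sgn -` B - V" by (auto simp: V_def)
    have "emeasure uniform_ball {x. t < norm x \<and> sgn x \<in> B} = emeasure uniform_ball (sgn -` B) - emeasure uniform_ball V"
      unfolding eq using sB
      by (intro emeasure_Diff) (auto simp: V_def U.emeasure_eq_measure simp del: emeasure_uniform_measure)
    also have "\<dots> = ennreal (U.prob (sgn -` B)) - ennreal (t ^ DIM('a) * U.prob (sgn -` B))"
      unfolding V using 3 by (simp add: U.emeasure_eq_measure ennreal_mult del: emeasure_uniform_measure)
    also have "\<dots> = ennreal ((1 - t ^ DIM('a)) * U.prob (sgn -` B))"
      using 3 by (subst ennreal_minus) (auto simp: left_diff_distrib)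
    also have "\<dots> = ennreal (1 - t ^ DIM('a)) * emeasure uniform_ball (sgn -` B)"
      using 3 by (simp add: U.emeasure_eq_measure ennreal_mult power_le_one del: emeasure_uniform_measure)
    finally show ?thesis using 3 by simp
  qed
qed

lemma sets_radial_measure[measurable_cong, simp]: "sets (radial_measure n) = sets borel"
  by (simp add: radial_measure_def)

lemma prob_space_radial_measure: assumes "n > 0" shows "prob_space (radial_measure n)"
proof
  have "emeasure (radial_measure n) {-1<..} = emeasure (radial_measure n) (space (radial_measure n))"
    unfolding radial_measure_def by (subst (1 2) emeasure_density) (auto intro!: nn_integral_cong simp: indicator_def)
  then show "emeasure (radial_measure n) (space (radial_measure n)) = 1"
    using emeasure_radial_measure_greaterThan[OF assms, of "-1"] assms by (simp add: zero_power)
qed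

text \<open>Polar coordinates in probabilistic form: under the uniform law on the ball, radius and
  direction are independent.\<close>

lemma distr_uniform_ball_polar:
  "distr (uniform_ball :: 'a::euclidean_space measure) (borel \<Otimes>\<^sub>M borel) (\<lambda>x. (norm x, sgn x)) =
    radial_measure DIM('a) \<Otimes>\<^sub>M distr uniform_ball borel sgn"
proof (rule pair_measure_eqI[symmetric])
  interpret U: prob_space "uniform_ball :: 'a measure" by (rule prob_space_uniform_ball)
  interpret R: prob_space "radial_measure DIM('a)" by (rule prob_space_radial_measure) simp
  interpret S: prob_space "distr (uniform_ball :: 'a measure) borel sgn"
    by (rule U.prob_space_distr) simp
  show "sigma_finite_measure (radial_measure DIM('a))"
    "sigma_finite_measure (distr (uniform_ball :: 'a measure) borel sgn)" by unfold_locales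
  show "sets (radial_measure DIM('a) \<Otimes>\<^sub>M distr (uniform_ball :: 'a measure) borel sgn) =
    sets (distr (uniform_ball :: 'a measure) (borel \<Otimes>\<^sub>M borel) (\<lambda>x. (norm x, sgn x)))"
    by (simp cong: sets_pair_measure_cong)
  fix A B assume A: "A \<in> sets (radial_measure DIM('a))" and B: "B \<in> sets (distr (uniform_ball :: 'a measure) borel sgn)"
  then have [measurable]: "A \<in> sets borel" "B \<in> sets borel" by simp_all
  have sB[measurable]: "sgn -` B \<in> sets borel" using measurable_sets[OF borel_measurable_sgn, of B] B by simp
  \<comment> \<open>With \<open>B\<close> fixed, the claim on rectangles becomes an equality of two
    measures on the line. Such measures, if finite on half-lines \<open>{x<..}\<close>, are
    determined by them, and there the cone formula applies.\<close>
  define M where "M = distr (density uniform_ball (indicator (sgn -` B))) borel (norm :: 'a \<Rightarrow> real)"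
  have M: "emeasure M C = emeasure uniform_ball {x. norm x \<in> C \<and> sgn x \<in> B}" if [measurable]: "C \<in> sets borel" for C
  proof -
    have "emeasure M C = (\<integral>\<^sup>+ x. indicator (sgn -` B) x * indicator (norm -` C) x \<partial>uniform_ball)"
      unfolding M_def using measurable_sets[of norm "borel :: 'a measure" borel C] that
      by (subst emeasure_distr) (auto simp: emeasure_density)
    also have "\<dots> = (\<integral>\<^sup>+ x. indicator {x. norm x \<in> C \<and> sgn x \<in> B} x \<partial>uniform_ball)"
      by (intro nn_integral_cong) (auto simp: indicator_def)
    also have "\<dots> = emeasure uniform_ball {x. norm x \<in> C \<and> sgn x \<in> B}"
      by (rule nn_integral_indicator) (simp, measurable)
    finally show ?thesis .
  qed
  have dB: "emeasure (distr (uniform_ball :: 'a measure) borel sgn) B = emeasure uniform_ball (sgn -` B)"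
    by (subst emeasure_distr) auto
  have "M = scale_measure (emeasure uniform_ball (sgn -` B)) (radial_measure DIM('a))"
  proof (rule measure_eqI_lessThan)
    fix x :: real
    show "emeasure M {x<..} < \<infinity>" by (simp add: M less_top U.emeasure_eq_measure)
    show "emeasure M {x<..} = emeasure (scale_measure (emeasure uniform_ball (sgn -` B)) (radial_measure DIM('a))) {x<..}"
      by (simp add: M emeasure_uniform_ball_greater emeasure_radial_measure_greaterThan mult.commute
        del: emeasure_uniform_measure)
  qed (simp_all add: M_def)
  then have "emeasure uniform_ball {x. norm x \<in> A \<and> sgn x \<in> B} = emeasure uniform_ball (sgn -` B) * emeasure (radial_measure DIM('a)) A"
    using M[of A] by simp
  moreover have "emeasure (distr (uniform_ball :: 'a measure) (borel \<Otimes>\<^sub>M borel) (\<lambda>x. (norm x, sgn x))) (A \<times> B) =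
    emeasure uniform_ball {x. norm x \<in> A \<and> sgn x \<in> B}"
    by (subst emeasure_distr) (auto simp: vimage_def)
  ultimately show "emeasure (radial_measure DIM('a)) A * emeasure (distr (uniform_ball :: 'a measure) borel sgn) B =
    emeasure (distr (uniform_ball :: 'a measure) (borel \<Otimes>\<^sub>M borel) (\<lambda>x. (norm x, sgn x))) (A \<times> B)"
    by (simp add: dB mult.commute)
qed

subsection \<open>Integration over the sphere\<close>

lemma sets_sphere_measure[measurable_cong]:
  "sets (sphere_measure :: 'a::euclidean_space measure) = sets (restrict_space borel (sphere 0 1))"
  unfolding sphere_measure_def by (rule sets_restrict_space_cong) simp

lemma prob_space_sphere_measure: "prob_space (sphere_measure :: 'a::euclidean_space measure)"
  by (rule prob_spaceI) (simp add: space_sphere_measure emeasure_sphere_measure_space)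

lemma borel_measurable_sphere_measure:
  fixes h :: "'a::euclidean_space \<Rightarrow> 'b::topological_space"
  assumes "continuous_on (sphere 0 1) h"
  shows "h \<in> borel_measurable sphere_measure"
  using borel_measurable_continuous_on_restrict[OF assms] by (simp cong: measurable_cong_sets add: sets_sphere_measure)

lemma integrable_sphere_measure:
  fixes h :: "'a::euclidean_space \<Rightarrow> real"
  assumes "continuous_on (sphere 0 1) h"
  shows "integrable sphere_measure h"
proof -
  interpret prob_space "sphere_measure :: 'a measure" by (rule prob_space_sphere_measure)
  have "bounded (h ` sphere 0 1)"
    using assms by (intro compact_imp_bounded compact_continuous_image) auto
  then obtain C where "\<And>z. z \<in> sphere 0 1 \<Longrightarrow> norm (h z) \<le> C"
    unfolding bounded_iff by blast
  then show ?thesis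
    by (intro integrable_const_bound[of _ C] AE_I2 borel_measurable_sphere_measure assms)
      (auto simp: space_sphere_measure)
qed

text \<open>Restricting to the sphere only drops the value \<open>sgn 0 = 0\<close>, which is taken
  at the single point \<open>0\<close>. The unrestricted image measure lives on \<open>borel\<close>
  and so fits the product in the polar formula.\<close>

lemma integral_sphere_measure:
  fixes h :: "'a::euclidean_space \<Rightarrow> real"
  assumes [measurable]: "h \<in> borel_measurable borel"
  shows "(\<integral>z. h z \<partial>sphere_measure) = (\<integral>z. h z \<partial>distr uniform_ball borel sgn)"
proof -
  have "(\<integral>z. h z \<partial>sphere_measure) = (\<integral>z. indicator (sphere 0 1) z *\<^sub>R h z \<partial>distr uniform_ball borel sgn)"
    unfolding sphere_measure_def by (rule integral_restrict_space) simp
  also have "\<dots> = (\<integral>z. h z \<partial>distr uniform_ball borel sgn)"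
  proof (rule integral_cong_AE)
    have "AE x in lborel. x \<noteq> (0::'a)" by (rule AE_lborel_singleton)
    then have "AE x in uniform_ball. x \<noteq> (0::'a)"
      by (intro AE_uniform_measureI) auto
    then have "AE x in uniform_ball. sgn x \<in> sphere (0::'a) 1"
      by eventually_elim (simp add: norm_sgn)
    then have "AE z in distr uniform_ball borel sgn. z \<in> sphere (0::'a) 1"
      by (subst AE_distr_iff) auto
    then show "AE z in distr uniform_ball borel sgn. indicator (sphere 0 1) z *\<^sub>R h z = h z"
      by eventually_elim auto
    show "(\<lambda>z. indicator (sphere 0 1) z *\<^sub>R h z) \<in> borel_measurable (distr uniform_ball borel sgn)"
      by (intro borel_measurable_scaleR borel_measurable_indicator) auto
  qed auto
  finally show ?thesis .
qed

text \<open>A convergent sequence together with its limit is compact, so \<open>k\<close> is bounded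
  along it, and a constant dominates since the sphere has measure 1.\<close>

lemma continuous_on_integral_sphere:
  fixes k :: "real \<Rightarrow> 'a::euclidean_space \<Rightarrow> real"
  assumes k: "continuous_on (T \<times> sphere 0 1) (\<lambda>(t, z). k t z)"
  shows "continuous_on T (\<lambda>t. \<integral>z. k t z \<partial>sphere_measure)"
  unfolding continuous_on_sequentially comp_def
proof (intro allI ballI impI, elim conjE)
  fix X a assume a: "a \<in> T" and X: "\<forall>n. X n \<in> T" "X \<longlonglongrightarrow> a"
  interpret prob_space "sphere_measure :: 'a measure" by (rule prob_space_sphere_measure)
  define K where "K = insert a (range X)"
  have "compact K" unfolding K_def by (rule compact_sequence_with_limit[OF X(2)])
  have "K \<subseteq> T" using a X by (auto simp: K_def)
  then have kK: "continuous_on (K \<times> sphere 0 1) (\<lambda>(t, z). k t z)"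
    by (intro continuous_on_subset[OF k]) auto
  then have "bounded ((\<lambda>(t, z). k t z) ` (K \<times> sphere 0 1))"
    using \<open>compact K\<close> by (intro compact_imp_bounded compact_continuous_image compact_Times) auto
  then obtain C where C: "\<And>t z. t \<in> K \<Longrightarrow> z \<in> sphere 0 1 \<Longrightarrow> norm (k t z) \<le> C"
    by (fastforce simp: bounded_iff)
  have meas: "k t \<in> borel_measurable sphere_measure" if "t \<in> K" for t
  proof (rule borel_measurable_sphere_measure)
    have "continuous_on (sphere 0 1) ((\<lambda>(t, z). k t z) \<circ> (\<lambda>z. (t, z)))"
      using that by (intro continuous_on_compose continuous_intros continuous_on_subset[OF kK]) auto
    then show "continuous_on (sphere 0 1) (k t)" by (simp add: comp_def)
  qed
  show "(\<lambda>n. \<integral>z. k (X n) z \<partial>sphere_measure) \<longlonglongrightarrow> (\<integral>z. k a z \<partial>sphere_measure)"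
  proof (rule integral_dominated_convergence[where w = "\<lambda>_. C"])
    show "AE z in sphere_measure. (\<lambda>n. k (X n) z) \<longlonglongrightarrow> k a z"
    proof (rule AE_I2)
      fix z :: 'a assume "z \<in> space sphere_measure"
      then have z: "z \<in> sphere 0 1" by (simp add: space_sphere_measure)
      have "continuous_on K ((\<lambda>(t, z). k t z) \<circ> (\<lambda>t. (t, z)))"
        using z by (intro continuous_on_compose continuous_intros continuous_on_subset[OF kK]) auto
      then show "(\<lambda>n. k (X n) z) \<longlonglongrightarrow> k a z"
        using X(2) by (auto simp: comp_def continuous_on_sequentially K_def)
    qed
    show "AE z in sphere_measure. norm (k (X n) z) \<le> C" for n
      using C[of "X n"] by (intro AE_I2) (simp add: space_sphere_measure K_def)
  qed (auto intro!: meas simp: K_def)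
qed

text \<open>Dominated convergence for difference quotients; the mean value inequality bounds them by
  the supremum of \<open>k\<close> over a compact interval times the sphere.\<close>

lemma has_real_derivative_integral_sphere:
  fixes g k :: "real \<Rightarrow> 'a::euclidean_space \<Rightarrow> real"
  assumes g: "\<And>t z. a < t \<Longrightarrow> t < b \<Longrightarrow> z \<in> sphere 0 1 \<Longrightarrow> ((\<lambda>t. g t z) has_real_derivative k t z) (at t)"
    and gc: "\<And>t. a < t \<Longrightarrow> t < b \<Longrightarrow> continuous_on (sphere 0 1) (g t)"
    and k: "continuous_on ({a<..<b} \<times> sphere 0 1) (\<lambda>(t, z). k t z)"
    and x: "a < x" "x < b"
  shows "((\<lambda>t. \<integral>z. g t z \<partial>sphere_measure) has_real_derivative (\<integral>z. k x z \<partial>sphere_measure)) (at x)"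
proof -
  interpret prob_space "sphere_measure :: 'a measure" by (rule prob_space_sphere_measure)
  have kx: "continuous_on (sphere 0 1) (k x)"
  proof -
    have "continuous_on (sphere 0 1) ((\<lambda>(t, z). k t z) \<circ> (\<lambda>z. (x, z)))"
      using x by (intro continuous_on_compose continuous_intros continuous_on_subset[OF k]) auto
    then show ?thesis by (simp add: comp_def)
  qed
  have "((\<lambda>t. \<integral>z. g t z \<partial>sphere_measure) has_real_derivative (\<integral>z. k x z \<partial>sphere_measure)) (at x within {a<..<b})"
    unfolding has_field_derivative_iff tendsto_at_iff_sequentially comp_def
  proof (intro allI impI)
    fix X assume X: "\<forall>i. X i \<in> {a<..<b} - {x}" "X \<longlonglongrightarrow> x"
    define K where "K = insert x (range X)"
    have K: "compact K" "K \<noteq> {}" "K \<subseteq> {a<..<b}"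
      unfolding K_def using compact_sequence_with_limit[OF X(2)] X x by auto
    \<comment> \<open>The mean value inequality needs a convex set, so the compact set
      \<open>K\<close> is replaced by the interval between its extreme points, which still lies
      inside the open interval.\<close>
    obtain l where l: "l \<in> K" "\<And>t. t \<in> K \<Longrightarrow> l \<le> t" using compact_attains_inf[OF K(1,2)] by auto
    obtain u where u: "u \<in> K" "\<And>t. t \<in> K \<Longrightarrow> t \<le> u" using compact_attains_sup[OF K(1,2)] by auto
    have lu: "{l..u} \<subseteq> {a<..<b}" using l(1) u(1) K(3) by fastforce
    then have "bounded ((\<lambda>(t, z). k t z) ` ({l..u} \<times> sphere 0 1))"
      by (intro compact_imp_bounded compact_continuous_image compact_Times continuous_on_subset[OF k]) auto
    then obtain C where C: "\<And>t z. t \<in> {l..u} \<Longrightarrow> z \<in> sphere 0 1 \<Longrightarrow> norm (k t z) \<le> C"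
      by (fastforce simp: bounded_iff)
    have Xi: "X i \<in> {l..u}" "X i \<noteq> x" "a < X i" "X i < b" for i using l u X(1) by (auto simp: K_def)
    have xlu: "x \<in> {l..u}" using l u by (auto simp: K_def)
    have "(\<lambda>i. \<integral>z. (g (X i) z - g x z) / (X i - x) \<partial>sphere_measure) \<longlonglongrightarrow> (\<integral>z. k x z \<partial>sphere_measure)"
    proof (rule integral_dominated_convergence[where w = "\<lambda>_. C"])
      show "AE z in sphere_measure. (\<lambda>i. (g (X i) z - g x z) / (X i - x)) \<longlonglongrightarrow> k x z"
      proof (rule AE_I2)
        fix z :: 'a assume "z \<in> space sphere_measure"
        then have "((\<lambda>t. g t z) has_real_derivative k x z) (at x)"
          using x by (intro g) (auto simp: space_sphere_measure)
        then show "(\<lambda>i. (g (X i) z - g x z) / (X i - x)) \<longlonglongrightarrow> k x z"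
          using X unfolding has_field_derivative_iff tendsto_at_iff_sequentially comp_def by auto
      qed
      show "AE z in sphere_measure. norm ((g (X i) z - g x z) / (X i - x)) \<le> C" for i
      proof (rule AE_I2)
        fix z :: 'a assume "z \<in> space sphere_measure"
        then have z: "z \<in> sphere 0 1" by (simp add: space_sphere_measure)
        have "norm (g (X i) z - g x z) \<le> C * norm (X i - x)"
        proof (rule field_differentiable_bound)
          show "convex {l..u}" by simp
          show "((\<lambda>t. g t z) has_field_derivative k t z) (at t within {l..u})" if "t \<in> {l..u}" for t
          proof -
            have "t \<in> {a<..<b}" using that lu by blast
            then show ?thesis using g[of t z] z by (auto intro: has_field_derivative_at_within)
          qed
        qed (use C z Xi xlu in auto)
        then show "norm ((g (X i) z - g x z) / (X i - x)) \<le> C"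
          using Xi(2)[of i] by (simp add: field_simps)
      qed
    qed (use x Xi in \<open>auto intro!: borel_measurable_sphere_measure kx gc continuous_on_divide continuous_on_diff continuous_on_const\<close>)
    moreover have eq: "(\<integral>z. (g (X i) z - g x z) / (X i - x) \<partial>sphere_measure) =
      ((\<integral>z. g (X i) z \<partial>sphere_measure) - (\<integral>z. g x z \<partial>sphere_measure)) / (X i - x)" for i
      using x Xi by (simp add: integrable_sphere_measure gc)
    ultimately show "(\<lambda>i. ((\<integral>z. g (X i) z \<partial>sphere_measure) - (\<integral>z. g x z \<partial>sphere_measure)) / (X i - x))
        \<longlonglongrightarrow> (\<integral>z. k x z \<partial>sphere_measure)" by (simp only: eq)
  qed
  then show ?thesis using x by (simp add: at_within_open[of x "{a<..<b}"])
qed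

text \<open>Since \<open>F\<close> vanishes off the ball, its Lebesgue integral is \<open>v\<close>
  times the integral against the uniform law. Writing \<open>x\<close> as
  \<open>norm x *\<^sub>R sgn x\<close> moves that to the product law, where Fubini separates radius
  and direction.\<close>

lemma integral_polar:
  fixes F :: "'a::euclidean_space \<Rightarrow> real"
  assumes F: "continuous_on UNIV F" and supp: "\<And>x. norm x \<ge> 1 \<Longrightarrow> F x = 0"
  shows "(\<integral>x. F x \<partial>lborel) = real DIM('a) * measure lborel (ball (0::'a) 1) *
    integral {0..1} (\<lambda>t. t ^ (DIM('a) - 1) * (\<integral>z. F (t *\<^sub>R z) \<partial>sphere_measure))"
proof -
  define v where "v = measure lborel (ball (0::'a) 1)"
  define g where "g t = (\<integral>z. F (t *\<^sub>R z) \<partial>sphere_measure)" for t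
  define D where "D = distr (uniform_ball :: 'a measure) borel sgn"
  interpret U: prob_space "uniform_ball :: 'a measure" by (rule prob_space_uniform_ball)
  interpret R: prob_space "radial_measure DIM('a)" by (rule prob_space_radial_measure) simp
  interpret S: prob_space D unfolding D_def by (rule U.prob_space_distr) simp
  interpret P: pair_sigma_finite "radial_measure DIM('a)" D ..
  have v: "v > 0" unfolding v_def by (rule content_ball_pos) simp
  have ev: "emeasure lborel (ball (0::'a) 1) = ennreal v"
    unfolding v_def using emeasure_unit_ball(2)[where 'a='a] by (simp add: emeasure_eq_ennreal_measure)
  have [measurable]: "F \<in> borel_measurable borel" by (rule borel_measurable_continuous_onI[OF F])
  have "bounded (F ` cball 0 1)"
    using F by (intro compact_imp_bounded compact_continuous_image continuous_on_subset[OF F]) auto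
  then obtain C where C: "\<And>x. x \<in> cball 0 1 \<Longrightarrow> norm (F x) \<le> C" unfolding bounded_iff by blast
  have "norm (F x) \<le> C" for x
  proof (cases "norm x \<le> 1")
    case False
    then show ?thesis using supp[of x] C[of 0] norm_ge_zero[of "F 0"] by (simp del: norm_ge_zero)
  qed (use C[of x] in simp)
  then have "integrable uniform_ball F" by (intro U.integrable_const_bound[of _ C]) auto
  moreover have FP: "F (norm x *\<^sub>R sgn x) = F x" for x
    by (cases "x = 0") (simp_all add: sgn_div_norm)
  ultimately have "integrable (distr uniform_ball (borel \<Otimes>\<^sub>M borel) (\<lambda>x. (norm x, sgn x))) (\<lambda>(t, z). F (t *\<^sub>R z))"
    by (subst integrable_distr_eq) (auto simp: FP)
  then have int: "integrable (radial_measure DIM('a) \<Otimes>\<^sub>M D) (\<lambda>(t, z). F (t *\<^sub>R z))"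
    by (simp add: distr_uniform_ball_polar D_def)
  have gc: "continuous_on T g" for T
    unfolding g_def by (rule continuous_on_integral_sphere)
      (auto simp: case_prod_unfold intro!: continuous_intros continuous_on_compose2[OF F])
  have [measurable]: "g \<in> borel_measurable borel" by (rule borel_measurable_continuous_onI[OF gc])
  have "(\<integral>x. F x \<partial>lborel) / v = (\<integral>x. F x \<partial>uniform_ball)"
  proof -
    have "uniform_ball = density lborel (\<lambda>x::'a. ennreal (indicator (ball 0 1) x / v))"
      unfolding uniform_measure_def ev using v
      by (intro density_cong) (auto simp: indicator_def divide_ennreal ennreal_1[symmetric] simp del: ennreal_1)
    then have "(\<integral>x. F x \<partial>uniform_ball) = (\<integral>x. (indicator (ball 0 1) x / v) * F x \<partial>lborel)"
      using v by (simp only:, subst integral_density)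
        (auto intro!: borel_measurable_divide borel_measurable_indicator)
    also have "\<dots> = (\<integral>x. F x / v \<partial>lborel)"
      using supp by (intro Bochner_Integration.integral_cong) (auto simp: indicator_def)
    finally show ?thesis by simp
  qed
  also have "\<dots> = (\<integral>p. (\<lambda>(t, z). F (t *\<^sub>R z)) p \<partial>distr uniform_ball (borel \<Otimes>\<^sub>M borel) (\<lambda>x. (norm x, sgn x)))"
    by (subst integral_distr) (auto simp: FP)
  also have "\<dots> = (\<integral>t. (\<integral>z. F (t *\<^sub>R z) \<partial>D) \<partial>radial_measure DIM('a))"
    unfolding distr_uniform_ball_polar D_def[symmetric] using P.integral_fst'[OF int] by simp
  also have "\<dots> = (\<integral>t. g t \<partial>radial_measure DIM('a))"
    unfolding g_def D_def by (intro Bochner_Integration.integral_cong refl integral_sphere_measure[symmetric]) simp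
  also have "\<dots> = (\<integral>t. (indicator {0..1} t * (real DIM('a) * t ^ (DIM('a) - 1))) * g t \<partial>lborel)"
    unfolding radial_measure_def by (subst integral_density) (auto simp: indicator_def)
  also have "\<dots> = (LINT t:{0..1}|lborel. real DIM('a) * (t ^ (DIM('a) - 1) * g t))"
    unfolding set_lebesgue_integral_def by (intro Bochner_Integration.integral_cong) auto
  also have "\<dots> = integral {0..1} (\<lambda>t. real DIM('a) * (t ^ (DIM('a) - 1) * g t))"
    by (intro set_borel_integral_eq_integral borel_integrable_atLeastAtMost' continuous_intros gc)
  also have "\<dots> = real DIM('a) * integral {0..1} (\<lambda>t. t ^ (DIM('a) - 1) * g t)" by simp
  finally show ?thesis using v by (simp add: g_def v_def field_simps)
qed

subsection \<open>The divergence theorem\<close>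

lemma integral_lborel_translate:
  fixes F :: "'a::euclidean_space \<Rightarrow> real"
  assumes [measurable]: "F \<in> borel_measurable borel"
  shows "(\<integral>x. F (x + b) \<partial>lborel) = (\<integral>x. F x \<partial>lborel)"
proof -
  have "(\<integral>x. F x \<partial>lborel) = (\<integral>x. F x \<partial>distr lborel borel ((+) b))"
    by (simp only: lborel_distr_plus)
  also have "\<dots> = (\<integral>x. F (x + b) \<partial>lborel)"
    by (subst integral_distr) (auto simp: add.commute)
  finally show ?thesis ..
qed

text \<open>Averaging \<open>F (x + b) - F x\<close>, written as the integral of the derivative along the segment,
  over all \<open>x\<close>: translation invariance makes the left side vanish and gives
  every slice on the right the same integral.\<close>

lemma integral_directional_derivative_eq_0:
  fixes F F' :: "'a::euclidean_space \<Rightarrow> real"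
  assumes der: "\<And>x. ((\<lambda>s. F (x + s *\<^sub>R b)) has_real_derivative F' x) (at 0)"
    and F: "continuous_on UNIV F" and F': "continuous_on UNIV F'"
    and supp: "\<And>x. norm x \<ge> 1 \<Longrightarrow> F x = 0" "\<And>x. norm x \<ge> 1 \<Longrightarrow> F' x = 0"
  shows "(\<integral>x. F' x \<partial>lborel) = 0"
proof -
  have [measurable]: "F \<in> borel_measurable borel" "F' \<in> borel_measurable borel"
    using F F' by (auto intro: borel_measurable_continuous_onI)
  have bounded_supp: "\<exists>C\<ge>0. \<forall>x. \<bar>G x\<bar> \<le> C * indicator (cball 0 1) x"
    if G: "continuous_on UNIV G" "\<And>x. norm x \<ge> 1 \<Longrightarrow> G x = 0" for G :: "'a \<Rightarrow> real"
  proof -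
    have "bounded (G ` cball 0 1)"
      by (intro compact_imp_bounded compact_continuous_image continuous_on_subset[OF G(1)]) auto
    then obtain C where C: "\<And>x. x \<in> cball 0 1 \<Longrightarrow> norm (G x) \<le> C" unfolding bounded_iff by blast
    have "C \<ge> 0" using C[of 0] norm_ge_zero[of "G 0"] by (simp del: norm_ge_zero)
    moreover have "\<bar>G x\<bar> \<le> C * indicator (cball 0 1) x" for x
      using C[of x] G(2)[of x] by (auto simp: indicator_def)
    ultimately show ?thesis by blast
  qed
  have intF: "integrable lborel F"
  proof -
    obtain C where C: "C \<ge> 0" "\<And>x. \<bar>F x\<bar> \<le> C * indicator (cball 0 1) x"
      using bounded_supp[OF F supp(1)] by blast
    have "integrable lborel (\<lambda>x. C * indicator (cball (0::'a) 1) x)"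
      using emeasure_lborel_cball_finite[of "0::'a" 1] by (intro integrable_mult_right) auto
    then show ?thesis
      by (rule Bochner_Integration.integrable_bound) (use C in \<open>auto intro!: AE_I2 intro: order_trans abs_ge_self\<close>)
  qed
  have intF2: "integrable lborel (\<lambda>x. F (x + b))"
  proof -
    have "integrable (distr lborel borel ((+) b)) F" using intF by (simp only: lborel_distr_plus)
    then show ?thesis by (subst (asm) integrable_distr_eq) (auto simp: add.commute)
  qed
  define H where "H = (\<lambda>(x, s). F' (x + s *\<^sub>R b) * indicator {0..1} s)"
  have [measurable]: "H \<in> borel_measurable (borel \<Otimes>\<^sub>M borel)" unfolding H_def by measurable
  obtain C where C: "C \<ge> 0" "\<And>x. \<bar>F' x\<bar> \<le> C * indicator (cball 0 1) x"
    using bounded_supp[OF F' supp(2)] by blast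
  \<comment> \<open>If \<open>x + s *\<^sub>R b\<close> lies in the closed unit ball and
    \<open>s \<in> {0..1}\<close>, then \<open>norm x \<le> 1 + norm b\<close>. So \<open>H\<close>
    is bounded and supported in a set of finite measure, as Fubini requires.\<close>
  define K where "K = cball (0::'a) (1 + norm b) \<times> {0..1::real}"
  have "bounded K" unfolding K_def by (intro bounded_Times) auto
  then have Kf: "emeasure lborel K < \<infinity>" by (rule emeasure_bounded_finite)
  have [measurable]: "K \<in> sets borel" unfolding K_def by (intro borel_closed closed_Times) auto
  have "integrable lborel (\<lambda>p. C * indicator K p)"
    using Kf by (intro integrable_mult_right) auto
  then have "integrable lborel H"
  proof (rule Bochner_Integration.integrable_bound)
    have "\<bar>H (x, s)\<bar> \<le> \<bar>C * indicator K (x, s)\<bar>" for x s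
    proof (cases "s \<in> {0..1} \<and> norm (x + s *\<^sub>R b) \<le> 1")
      case True
      have "norm x \<le> norm (x + s *\<^sub>R b) + norm (s *\<^sub>R b)"
        using norm_triangle_ineq4[of "x + s *\<^sub>R b" "s *\<^sub>R b"] by simp
      also have "\<dots> \<le> 1 + norm b" using True by (intro add_mono) (auto simp: mult_left_le_one_le)
      finally have "(x, s) \<in> K" using True by (auto simp: K_def)
      then show ?thesis using C(1) C(2)[of "x + s *\<^sub>R b"] True by (simp add: H_def)
    next
      case False
      then have "H (x, s) = 0" using supp(2)[of "x + s *\<^sub>R b"] by (auto simp: H_def indicator_def)
      then show ?thesis by simp
    qed
    then show "AE p in lborel. norm (H p) \<le> norm (C * indicator K p)" by auto
  qed (simp add: borel_prod[symmetric])
  then have intH: "integrable (lborel \<Otimes>\<^sub>M lborel) H" by (simp only: lborel_prod)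
  have "(\<integral>x. F (x + b) - F x \<partial>lborel) = 0"
    using intF intF2 by (simp add: integral_lborel_translate)
  moreover have "F (x + b) - F x = (\<integral>s. H (x, s) \<partial>lborel)" for x
  proof -
    have "(\<integral>s. F' (x + s *\<^sub>R b) * indicator {0..1} s \<partial>lborel) = F (x + 1 *\<^sub>R b) - F (x + 0 *\<^sub>R b)"
    proof (rule integral_FTC_Icc_real)
      fix s :: real
      show "((\<lambda>s. F (x + s *\<^sub>R b)) has_real_derivative F' (x + s *\<^sub>R b)) (at s)"
        using der[of "x + s *\<^sub>R b"] DERIV_shift[of "\<lambda>u. F (x + u *\<^sub>R b)" "F' (x + s *\<^sub>R b)" 0 s]
        by (simp add: algebra_simps)
      have "continuous_on UNIV (\<lambda>s. F' (x + s *\<^sub>R b))"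
        by (intro continuous_on_compose2[OF F'] continuous_intros) auto
      then show "isCont (\<lambda>s. F' (x + s *\<^sub>R b)) s" by (simp add: continuous_on_eq_continuous_at)
    qed simp
    then show ?thesis by (simp add: H_def)
  qed
  ultimately have "0 = (\<integral>x. (\<integral>s. H (x, s) \<partial>lborel) \<partial>lborel)" by simp
  also have "\<dots> = (\<integral>s. (\<integral>x. H (x, s) \<partial>lborel) \<partial>lborel)"
    using lborel_pair.Fubini_integral[of "\<lambda>s x. H (x, s)"] lborel_pair.integrable_product_swap[OF intH]
    by (simp add: case_prod_unfold)
  also have "\<dots> = (\<integral>s. indicator {0..1::real} s * (\<integral>x. F' x \<partial>lborel) \<partial>lborel)"
    by (intro Bochner_Integration.integral_cong) (auto simp: H_def integral_lborel_translate)
  finally show ?thesis by simp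
qed

text \<open>This is why the cutoff is squared: the positive part has a kink at \<open>0\<close>,
  while the difference quotient of its square there is at most \<open>\<bar>h\<bar>\<close>.\<close>

lemma has_real_derivative_power2_max_0:
  "((\<lambda>y::real. (max 0 y)\<^sup>2) has_real_derivative 2 * max 0 y) (at y)"
proof -
  consider "y > 0" | "y < 0" | "y = 0" by linarith
  then show ?thesis
  proof cases
    case 1
    then have "\<forall>\<^sub>F z in nhds y. z > 0" using eventually_nhds_in_open[of "{0<..}" y] by auto
    then have ev: "\<forall>\<^sub>F z in nhds y. (max 0 z)\<^sup>2 = z\<^sup>2" by eventually_elim auto
    show ?thesis using 1 by (subst DERIV_cong_ev[OF refl ev refl]) (auto intro!: derivative_eq_intros)
  next
    case 2
    then have "\<forall>\<^sub>F z in nhds y. z < 0" using eventually_nhds_in_open[of "{..<0}" y] by auto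
    then have ev: "\<forall>\<^sub>F z in nhds y. (max 0 z)\<^sup>2 = 0" by eventually_elim auto
    show ?thesis using 2 by (subst DERIV_cong_ev[OF refl ev refl]) auto
  next
    case 3
    have "((\<lambda>h::real. (max 0 h)\<^sup>2 / h) \<longlongrightarrow> 0) (at 0)"
    proof (rule Lim_null_comparison)
      show "\<forall>\<^sub>F h::real in at 0. norm ((max 0 h)\<^sup>2 / h) \<le> \<bar>h\<bar>"
        by (intro always_eventually) (auto simp: max_def power2_eq_square)
      show "((\<lambda>h::real. \<bar>h\<bar>) \<longlongrightarrow> 0) (at 0)" by (auto intro!: tendsto_eq_intros)
    qed
    then show ?thesis using 3 by (simp add: has_field_derivative_iff)
  qed
qed

text \<open>Nothing is known about \<open>g\<close> outside the ball. Since \<open>R < 1\<close>,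
  the open ball and the open complement of \<open>cball 0 R\<close> cover the space, and the product
  is zero on the latter.\<close>

lemma continuous_on_cutoff_mult:
  fixes h g :: "'a::euclidean_space \<Rightarrow> real"
  assumes h: "continuous_on UNIV h" "\<And>x. norm x \<ge> R \<Longrightarrow> h x = 0" and "R < 1"
    and g: "continuous_on (ball 0 1) g"
  shows "continuous_on UNIV (\<lambda>x. h x * g x)"
proof -
  have "continuous_on (ball 0 1) (\<lambda>x. h x * g x)"
    by (intro continuous_intros g continuous_on_subset[OF h(1)]) auto
  moreover have "continuous_on (- cball 0 R) (\<lambda>x. h x * g x)"
    by (rule continuous_on_eq[of _ "\<lambda>_. 0"]) (auto simp: h(2))
  moreover have "ball 0 1 \<union> - cball 0 R = (UNIV :: 'a set)" using \<open>R < 1\<close> by auto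
  ultimately show ?thesis
    using continuous_on_open_Un[of "ball 0 1" "- cball 0 R" "\<lambda>x. h x * g x"] by auto
qed

text \<open>A sequence converging in \<open>{0..<1}\<close> stays, with its limit, below some
  \<open>u < 1\<close>.\<close>

lemma continuous_on_half_open:
  fixes h :: "real \<Rightarrow> real"
  assumes "\<And>u. u < 1 \<Longrightarrow> continuous_on {0..u} h"
  shows "continuous_on {0..<1} h"
  unfolding continuous_on_sequentially comp_def
proof (intro allI ballI impI, elim conjE)
  fix X a assume a: "a \<in> {0..<1::real}" and X: "\<forall>n. X n \<in> {0..<1}" "X \<longlonglongrightarrow> a"
  define K where "K = insert a (range X)"
  have "compact K" unfolding K_def by (rule compact_sequence_with_limit[OF X(2)])
  moreover have "K \<noteq> {}" by (simp add: K_def)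
  ultimately obtain u where u: "u \<in> K" "\<And>t. t \<in> K \<Longrightarrow> t \<le> u"
    using compact_attains_sup[of K] by auto
  have "u < 1" using u(1) a X(1) by (auto simp: K_def)
  from assms[OF this] have "\<And>X. (\<forall>n. X n \<in> {0..u}) \<and> X \<longlonglongrightarrow> a \<Longrightarrow> (\<lambda>n. h (X n)) \<longlonglongrightarrow> h a"
    using a u(2)[of a] by (auto simp: continuous_on_sequentially comp_def K_def)
  then show "(\<lambda>n. h (X n)) \<longlonglongrightarrow> h a"
    using X u(2) by (auto simp: K_def)
qed

lemma has_real_derivative_integral_0:
  fixes h :: "real \<Rightarrow> real"
  assumes h: "continuous_on {0..<1} h" and t: "0 < t" "t < 1"
  shows "((\<lambda>u. integral {0..u} h) has_real_derivative h t) (at t)"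
proof -
  define s where "s = (t + 1) / 2"
  have s: "t < s" "s < 1" using t by (auto simp: s_def field_simps)
  have "((\<lambda>u. integral {0..u} h) has_real_derivative h t) (at t within {0..s})"
    using s t by (intro integral_has_real_derivative continuous_on_subset[OF h]) auto
  then have "((\<lambda>u. integral {0..u} h) has_real_derivative h t) (at t within {0<..<s})"
    by (rule has_field_derivative_subset) auto
  then show ?thesis using s t by (simp add: at_within_open[of t "{0<..<s}"])
qed

lemma continuous_on_integral_0:
  fixes h :: "real \<Rightarrow> real"
  assumes h: "continuous_on {0..<1} h" and "r < 1"
  shows "continuous_on {0..r} (\<lambda>u. integral {0..u} h)"
  using assms(2)
  by (intro indefinite_integral_continuous_1 integrable_continuous_real continuous_on_subset[OF h]) auto

text \<open>Differentiating the hypothesis in \<open>R\<close> once shows that \<open>k\<close> has vanishing primitive.\<close>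

lemma integral_cutoff_eq_0_imp_eq_0:
  fixes k :: "real \<Rightarrow> real"
  assumes k: "continuous_on {0..<1} k"
    and 0: "\<And>R. 0 < R \<Longrightarrow> R < 1 \<Longrightarrow> integral {0..R} (\<lambda>t. (R\<^sup>2 - t\<^sup>2) * k t) = 0"
    and t: "0 < t" "t < 1"
  shows "k t = 0"
proof -
  define K where "K = (\<lambda>u. integral {0..u} k)"
  define J where "J = (\<lambda>u. integral {0..u} (\<lambda>t. t\<^sup>2 * k t))"
  have jc: "continuous_on {0..<1} (\<lambda>t. t\<^sup>2 * k t)" by (intro continuous_intros k)
  have dK: "(K has_real_derivative k u) (at u)" if "0 < u" "u < 1" for u
    unfolding K_def by (rule has_real_derivative_integral_0[OF k that])
  have dJ: "(J has_real_derivative u\<^sup>2 * k u) (at u)" if "0 < u" "u < 1" for u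
    unfolding J_def by (rule has_real_derivative_integral_0[OF jc that])
  have KJ: "u\<^sup>2 * K u - J u = 0" if u: "0 < u" "u < 1" for u
  proof -
    have "integral {0..u} (\<lambda>t. (u\<^sup>2 - t\<^sup>2) * k t) = integral {0..u} (\<lambda>t. u\<^sup>2 * k t - t\<^sup>2 * k t)"
      by (simp add: algebra_simps)
    also have "\<dots> = integral {0..u} (\<lambda>t. u\<^sup>2 * k t) - J u"
      unfolding J_def using u
      by (intro Henstock_Kurzweil_Integration.integral_diff integrable_continuous_real)
        (auto intro!: continuous_intros continuous_on_subset[OF k])
    finally show ?thesis using 0[OF u] by (simp add: K_def)
  qed
  have local0: "f' = 0" if u: "0 < u" "u < 1" and f: "(f has_real_derivative f') (at u)"
    and f0: "\<And>v. 0 < v \<Longrightarrow> v < 1 \<Longrightarrow> f v = 0" for f :: "real \<Rightarrow> real" and f' u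
  proof -
    have "\<forall>\<^sub>F v in nhds u. f v = 0"
      using eventually_nhds_in_open[of "{0<..<1}" u] u by (auto elim!: eventually_mono simp: f0)
    then have "((\<lambda>_. 0) has_real_derivative f') (at u)"
      using f DERIV_cong_ev[of u u f "\<lambda>_. 0" f' f'] by simp
    then show ?thesis using DERIV_unique[OF _ DERIV_const] by blast
  qed
  have K0: "K u = 0" if u: "0 < u" "u < 1" for u
  proof -
    \<comment> \<open>The two terms \<open>u\<^sup>2 * k u\<close> cancel, which leaves only the
      primitive \<open>K\<close>.\<close>
    have "((\<lambda>u. u\<^sup>2 * K u - J u) has_real_derivative 2 * u * K u) (at u)"
      by (rule derivative_eq_intros dK[OF u] dJ[OF u] refl)+ (simp add: algebra_simps)
    from local0[OF u this KJ] show ?thesis using u by simp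
  qed
  show ?thesis by (rule local0[OF t dK[OF t] K0])
qed

lemma continuous_on_ball_polar:
  fixes g :: "'a::euclidean_space \<Rightarrow> 'b::topological_space"
  assumes "continuous_on (ball 0 1) g"
  shows "continuous_on ({0..<1} \<times> sphere 0 1) (\<lambda>(t, z). g (t *\<^sub>R z))"
  unfolding case_prod_unfold
  by (rule continuous_on_compose2[OF assms]) (auto intro!: continuous_intros)

lemma continuous_on_sphere_ball:
  fixes g :: "'a::euclidean_space \<Rightarrow> 'b::topological_space"
  assumes "continuous_on (ball 0 1) g" "0 \<le> t" "t < 1"
  shows "continuous_on (sphere 0 1) (\<lambda>z. g (t *\<^sub>R z))"
  by (rule continuous_on_compose2[OF assms(1)]) (use assms in \<open>auto intro!: continuous_intros\<close>)

section \<open>Flux and divergence of a vector field on the ball\<close>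

locale ball_field =
  fixes V W :: "'a::euclidean_space \<Rightarrow> 'a \<Rightarrow> real"
  assumes der: "\<And>b x. b \<in> Basis \<Longrightarrow> x \<in> ball 0 1 \<Longrightarrow>
      ((\<lambda>s. V b (x + s *\<^sub>R b)) has_real_derivative W b x) (at 0)"
    and contV: "\<And>b. b \<in> Basis \<Longrightarrow> continuous_on (ball 0 1) (V b)"
    and contW: "\<And>b. b \<in> Basis \<Longrightarrow> continuous_on (ball 0 1) (W b)"
    and dim: "DIM('a) \<ge> 2"
begin

text \<open>The field has components \<open>V b\<close>, and \<open>z\<close> is the outer normal.
  As the measure is normalized, the true flux through the sphere of radius \<open>t\<close> carries
  a further factor proportional to \<open>t ^ (DIM('a) - 1)\<close>; hence the powers of
  \<open>t\<close> below.\<close>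

definition flux :: "real \<Rightarrow> real" where
  "flux t = (\<integral>z. (\<Sum>b\<in>Basis. V b (t *\<^sub>R z) * (z \<bullet> b)) \<partial>sphere_measure)"

definition divergence :: "real \<Rightarrow> real" where
  "divergence t = (\<integral>z. (\<Sum>b\<in>Basis. W b (t *\<^sub>R z)) \<partial>sphere_measure)"

lemma continuous_on_flux: "continuous_on {0..<1} flux"
  unfolding flux_def
  by (rule continuous_on_integral_sphere)
    (auto simp: case_prod_unfold
      intro!: continuous_intros continuous_on_ball_polar[OF contV, unfolded case_prod_unfold])

lemma continuous_on_divergence: "continuous_on {0..<1} divergence"
  unfolding divergence_def
  by (rule continuous_on_integral_sphere)
    (auto simp: case_prod_unfold
      intro!: continuous_intros continuous_on_ball_polar[OF contW, unfolded case_prod_unfold])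

text \<open>The divergence theorem is tested against the radial cutoff \<open>(R\<^sup>2 - |x|\<^sup>2)\<^sub>+\<^sup>2\<close>.\<close>

lemma integral_cutoff_divergence:
  assumes R: "0 < R" "R < 1"
  shows "integral {0..R} (\<lambda>t. t ^ (DIM('a) - 1) *
    ((R\<^sup>2 - t\<^sup>2)\<^sup>2 * divergence t - 4 * (R\<^sup>2 - t\<^sup>2) * t * flux t)) = 0"
proof -
  define m where "m x = max 0 (R\<^sup>2 - (norm x)\<^sup>2)" for x :: 'a
  have m0: "m x = 0" if "norm x \<ge> R" for x
    using power_mono[OF that, of 2] R by (simp add: m_def)
  have mc: "continuous_on UNIV m" unfolding m_def by (intro continuous_intros)
  define F where "F b x = (m x)\<^sup>2 * V b x" for b x
  \<comment> \<open>Product rule: the derivative of \<open>(m x)\<^sup>2\<close> in direction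
    \<open>b\<close> is \<open>2 * m x * (- 2 * (x \<bullet> b))\<close>.\<close>
  define F' where "F' b x = (m x)\<^sup>2 * W b x - 4 * (m x * ((x \<bullet> b) * V b x))" for b x
  have Fc: "continuous_on UNIV (F b)" if "b \<in> Basis" for b
    unfolding F_def
    by (rule continuous_on_cutoff_mult[OF _ _ R(2)]) (auto intro!: continuous_intros mc contV that simp: m0)
  have F'c: "continuous_on UNIV (F' b)" if "b \<in> Basis" for b
  proof -
    have "continuous_on UNIV (\<lambda>x. (m x)\<^sup>2 * W b x)"
      by (rule continuous_on_cutoff_mult[OF _ _ R(2)]) (auto intro!: continuous_intros mc contW that simp: m0)
    moreover have "continuous_on UNIV (\<lambda>x. m x * ((x \<bullet> b) * V b x))"
      by (rule continuous_on_cutoff_mult[OF mc m0 R(2)]) (auto intro!: continuous_intros contV that)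
    ultimately show ?thesis unfolding F'_def by (intro continuous_on_diff continuous_on_mult_left)
  qed
  have supp: "F b x = 0" "F' b x = 0" if "norm x \<ge> 1" for b x
    using m0[of x] that R by (auto simp: F_def F'_def)
  have Fder: "((\<lambda>s. F b (x + s *\<^sub>R b)) has_real_derivative F' b x) (at 0)" if b: "b \<in> Basis" for b x
  proof (cases "norm x < 1")
    case True
    have n: "((\<lambda>s. R\<^sup>2 - (norm (x + s *\<^sub>R b))\<^sup>2) has_real_derivative - (2 * (x \<bullet> b))) (at 0)"
      unfolding power2_norm_eq_inner
      by (auto intro!: derivative_eq_intros simp: inner_left_distrib inner_right_distrib inner_commute)
    have "((\<lambda>s. (m (x + s *\<^sub>R b))\<^sup>2) has_real_derivative (2 * m x) * - (2 * (x \<bullet> b))) (at 0)"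
      unfolding m_def using DERIV_chain2[OF has_real_derivative_power2_max_0 n] by simp
    from DERIV_mult[OF this der[OF b]] True show ?thesis
      by (simp add: F_def F'_def algebra_simps)
  next
    \<comment> \<open>\<open>V\<close> and \<open>W\<close> are unconstrained here, but
      \<open>R < 1 \<le> norm x\<close> makes \<open>F b\<close> vanish in a neighbourhood of
      \<open>x\<close>.\<close>
    case False
    have "\<forall>\<^sub>F s in nhds 0. norm (x + s *\<^sub>R b) > R"
    proof -
      have "((\<lambda>s. norm (x + s *\<^sub>R b)) \<longlongrightarrow> norm (x + 0 *\<^sub>R b)) (nhds 0)"
        by (intro tendsto_intros filterlim_ident)
      then show ?thesis using False R by (intro order_tendstoD(1)[of _ "norm x"]) auto
    qed
    then have ev: "\<forall>\<^sub>F s in nhds 0. F b (x + s *\<^sub>R b) = 0"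
      by eventually_elim (simp add: F_def m0)
    have "F' b x = 0" using False by (intro supp) auto
    then show ?thesis by (subst DERIV_cong_ev[OF refl ev refl]) auto
  qed
  have intF': "integrable lborel (F' b)" if "b \<in> Basis" for b
  proof -
    have "integrable lborel (\<lambda>x. indicator (cball 0 1) x *\<^sub>R F' b x)"
      by (intro borel_integrable_compact continuous_on_subset[OF F'c[OF that]]) auto
    moreover have eq: "indicator (cball 0 1) x *\<^sub>R F' b x = F' b x" for x
      using supp(2)[of x b] by (auto simp: indicator_def)
    ultimately show ?thesis by (simp only: eq)
  qed
  define G where "G x = (\<Sum>b\<in>Basis. F' b x)" for x
  have "(\<integral>x. G x \<partial>lborel) = (\<Sum>b\<in>Basis. \<integral>x. F' b x \<partial>lborel)"
    unfolding G_def by (rule Bochner_Integration.integral_sum) (rule intF')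
  also have "\<dots> = 0"
    by (intro sum.neutral ballI integral_directional_derivative_eq_0[OF Fder Fc F'c supp])
  finally have G0: "(\<integral>x. G x \<partial>lborel) = 0" .
  have Gc: "continuous_on UNIV G" unfolding G_def by (intro continuous_intros F'c)
  have Gs: "G x = 0" if "norm x \<ge> R" for x
    using m0[OF that] by (simp add: G_def F'_def)
  define g where "g t = t ^ (DIM('a) - 1) * (\<integral>z. G (t *\<^sub>R z) \<partial>sphere_measure)" for t
  have "integral {0..1} g = 0"
  proof -
    have "G x = 0" if "norm x \<ge> 1" for x using Gs[of x] that R by simp
    then have "real DIM('a) * measure lborel (ball (0::'a) 1) * integral {0..1} g = 0"
      unfolding g_def using integral_polar[OF Gc] G0 by simp
    moreover have "real DIM('a) * measure lborel (ball (0::'a) 1) > 0"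
      by (intro mult_pos_pos content_ball_pos) auto
    ultimately show ?thesis by simp
  qed
  moreover have "integral {0..1} g = integral {0..R} g + integral {R..1} g"
  proof (rule Henstock_Kurzweil_Integration.integral_combine[symmetric])
    have "continuous_on {0..1} (\<lambda>t. \<integral>z. G (t *\<^sub>R z) \<partial>sphere_measure)"
      unfolding case_prod_unfold
      by (rule continuous_on_integral_sphere, unfold case_prod_unfold,
          rule continuous_on_compose2[OF Gc]) (auto intro!: continuous_intros)
    then show "g integrable_on {0..1}"
      unfolding g_def by (intro integrable_continuous_real continuous_intros)
  qed (use R in auto)
  moreover have "integral {R..1} g = integral {R..1} (\<lambda>_. 0)"
  proof (rule Henstock_Kurzweil_Integration.integral_cong)
    fix t assume t: "t \<in> {R..1}"
    have "(\<integral>z. G (t *\<^sub>R z) \<partial>sphere_measure) = (\<integral>z. 0 \<partial>(sphere_measure :: 'a measure))"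
      using t R by (intro Bochner_Integration.integral_cong refl Gs) (auto simp: space_sphere_measure)
    then show "g t = 0" by (simp add: g_def)
  qed
  moreover have "integral {0..R} g = integral {0..R} (\<lambda>t. t ^ (DIM('a) - 1) *
    ((R\<^sup>2 - t\<^sup>2)\<^sup>2 * divergence t - 4 * (R\<^sup>2 - t\<^sup>2) * t * flux t))"
  proof (rule Henstock_Kurzweil_Integration.integral_cong)
    fix t assume t: "t \<in> {0..R}"
    have Vc: "continuous_on (sphere 0 1) (\<lambda>z. V b (t *\<^sub>R z))" if "b \<in> Basis" for b
      using continuous_on_sphere_ball[OF contV[OF that]] t R by simp
    have Wc: "continuous_on (sphere 0 1) (\<lambda>z. W b (t *\<^sub>R z))" if "b \<in> Basis" for b
      using continuous_on_sphere_ball[OF contW[OF that]] t R by simp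
    have "t\<^sup>2 \<le> R\<^sup>2" using t by (intro power_mono) auto
    then have mt: "m (t *\<^sub>R z) = R\<^sup>2 - t\<^sup>2" if "z \<in> sphere 0 1" for z
      using that by (simp add: m_def)
    \<comment> \<open>On the sphere of radius \<open>t\<close> the cutoff is constant and
      \<open>x \<bullet> b\<close> becomes \<open>t * (z \<bullet> b)\<close>, so both factors leave
      the spherical integral.\<close>
    have "(\<integral>z. G (t *\<^sub>R z) \<partial>sphere_measure) = (\<integral>z. (R\<^sup>2 - t\<^sup>2)\<^sup>2 * (\<Sum>b\<in>Basis. W b (t *\<^sub>R z)) -
        4 * (R\<^sup>2 - t\<^sup>2) * t * (\<Sum>b\<in>Basis. V b (t *\<^sub>R z) * (z \<bullet> b)) \<partial>sphere_measure)"
    proof (rule Bochner_Integration.integral_cong[OF refl])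
      fix z :: 'a assume "z \<in> space sphere_measure"
      then have "m (t *\<^sub>R z) = R\<^sup>2 - t\<^sup>2" by (intro mt) (simp add: space_sphere_measure)
      then show "G (t *\<^sub>R z) = (R\<^sup>2 - t\<^sup>2)\<^sup>2 * (\<Sum>b\<in>Basis. W b (t *\<^sub>R z)) -
        4 * (R\<^sup>2 - t\<^sup>2) * t * (\<Sum>b\<in>Basis. V b (t *\<^sub>R z) * (z \<bullet> b))"
        unfolding G_def F'_def sum_subtractf sum_distrib_left by (simp only: inner_scaleR_left mult_ac)
    qed
    also have "\<dots> = (R\<^sup>2 - t\<^sup>2)\<^sup>2 * divergence t - 4 * (R\<^sup>2 - t\<^sup>2) * t * flux t"
      unfolding divergence_def flux_def using t R
      by (subst Bochner_Integration.integral_diff)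
        (simp_all add: integrable_sphere_measure continuous_on_sum continuous_on_mult Vc Wc
          continuous_on_inner)
    finally show "g t = t ^ (DIM('a) - 1) *
      ((R\<^sup>2 - t\<^sup>2)\<^sup>2 * divergence t - 4 * (R\<^sup>2 - t\<^sup>2) * t * flux t)" by (simp add: g_def)
  qed
  ultimately show ?thesis by simp
qed

text \<open>\<open>E\<close> is the claimed value of \<open>t ^ n * flux t\<close>. Integration by
  parts of \<open>(R\<^sup>2 - t\<^sup>2)\<^sup>2 * e t\<close> has no boundary terms, because the
  cutoff vanishes at \<open>R\<close> and \<open>E\<close> at \<open>0\<close>. Subtracting the
  result from the cutoff identity shows that the error \<open>k\<close> integrates to zero against
  \<open>R\<^sup>2 - t\<^sup>2\<close> for every \<open>R\<close>.\<close>

theorem flux_eq_integral_divergence: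
  assumes r: "0 \<le> r" "r < 1"
  shows "r ^ (DIM('a) - 1) * flux r = integral {0..r} (\<lambda>t. t ^ (DIM('a) - 1) * divergence t)"
proof (cases "r = 0")
  case True
  \<comment> \<open>Dimension at least 2 makes the exponent positive, so the left side vanishes at
    \<open>0\<close>.\<close>
  then show ?thesis using dim by (simp add: zero_power)
next
  case False
  define n where "n = DIM('a) - 1"
  define e where "e t = t ^ n * divergence t" for t
  define E where "E u = integral {0..u} e" for u
  define k where "k t = 4 * t * (E t - t ^ n * flux t)" for t
  have ec: "continuous_on {0..<1} e" unfolding e_def by (intro continuous_intros continuous_on_divergence)
  have dE: "(E has_real_derivative e u) (at u)" if "0 < u" "u < 1" for u
    unfolding E_def by (rule has_real_derivative_integral_0[OF ec that])
  have Ec: "continuous_on {0..u} E" if "u < 1" for u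
    unfolding E_def by (rule continuous_on_integral_0[OF ec that])
  have Ec1: "continuous_on {0..<1} E"
    by (rule continuous_on_half_open) (rule Ec)
  have kc: "continuous_on {0..<1} k" unfolding k_def by (intro continuous_intros Ec1 continuous_on_flux)
  have "k r = 0"
  proof (rule integral_cutoff_eq_0_imp_eq_0[OF kc])
    fix R :: real assume R: "0 < R" "R < 1"
    have "((\<lambda>t. (R\<^sup>2 - t\<^sup>2)\<^sup>2 * e t - 4 * t * (R\<^sup>2 - t\<^sup>2) * E t) has_integral
        ((R\<^sup>2 - R\<^sup>2)\<^sup>2 * E R - (R\<^sup>2 - 0\<^sup>2)\<^sup>2 * E 0)) {0..R}"
    proof (rule fundamental_theorem_of_calculus_interior)
      fix t assume "t \<in> {0<..<R}"
      then have t: "0 < t" "t < 1" using R by auto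
      have "((\<lambda>t. (R\<^sup>2 - t\<^sup>2)\<^sup>2 * E t) has_real_derivative
          ((R\<^sup>2 - t\<^sup>2)\<^sup>2 * e t - 4 * t * (R\<^sup>2 - t\<^sup>2) * E t)) (at t)"
        by (rule derivative_eq_intros dE[OF t] refl)+ (simp add: algebra_simps power2_eq_square)
      then show "((\<lambda>t. (R\<^sup>2 - t\<^sup>2)\<^sup>2 * E t) has_vector_derivative
          ((R\<^sup>2 - t\<^sup>2)\<^sup>2 * e t - 4 * t * (R\<^sup>2 - t\<^sup>2) * E t)) (at t)"
        by (simp add: has_real_derivative_iff_has_vector_derivative)
    qed (use R in \<open>auto intro!: continuous_intros Ec\<close>)
    then have 1: "((\<lambda>t. (R\<^sup>2 - t\<^sup>2)\<^sup>2 * e t - 4 * t * (R\<^sup>2 - t\<^sup>2) * E t) has_integral 0) {0..R}"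
      by (simp add: E_def)
    have "(\<lambda>t. t ^ n * ((R\<^sup>2 - t\<^sup>2)\<^sup>2 * divergence t - 4 * (R\<^sup>2 - t\<^sup>2) * t * flux t)) integrable_on {0..R}"
      using R by (intro integrable_continuous_real continuous_intros
          continuous_on_subset[OF continuous_on_flux] continuous_on_subset[OF continuous_on_divergence]) auto
    then have 2: "((\<lambda>t. t ^ n * ((R\<^sup>2 - t\<^sup>2)\<^sup>2 * divergence t - 4 * (R\<^sup>2 - t\<^sup>2) * t * flux t)) has_integral 0) {0..R}"
      using integral_cutoff_divergence[OF R] by (simp add: has_integral_iff n_def)
    have "((\<lambda>t. (R\<^sup>2 - t\<^sup>2) * k t) has_integral 0 - 0) {0..R}"
      using has_integral_diff[OF 2 1]
      by (rule has_integral_eq[rotated]) (simp add: k_def e_def algebra_simps)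
    then show "integral {0..R} (\<lambda>t. (R\<^sup>2 - t\<^sup>2) * k t) = 0" by (simp add: has_integral_iff)
  qed (use r False in auto)
  then show ?thesis using False by (simp add: k_def E_def e_def[abs_def] n_def)
qed

end

subsection \<open>The differential inequality\<close>

text \<open>In the proof \<open>P\<close> is \<open>r\<^sup>n\<^sup>-\<^sup>1 \<psi>\<close> times the integrating factor
  \<open>(1 - r\<^sup>2)\<^sup>-\<^sup>(\<^sup>n\<^sup>-\<^sup>2\<^sup>)\<close>, where \<open>n = m + 2\<close>.\<close>

lemma log_growth:
  fixes \<phi> \<psi> B D :: "real \<Rightarrow> real" and m :: nat
  assumes \<phi>1: "\<And>t. 0 \<le> t \<Longrightarrow> t < 1 \<Longrightarrow> \<phi> t \<ge> 1"
    and d\<phi>: "\<And>t. 0 < t \<Longrightarrow> t < 1 \<Longrightarrow> (\<phi> has_real_derivative \<psi> t) (at t)"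
    and \<psi>c: "continuous_on {0..<1} \<psi>" and Dc: "continuous_on {0..<1} D"
    and flux: "\<And>t. 0 \<le> t \<Longrightarrow> t < 1 \<Longrightarrow> t ^ Suc m * \<psi> t = integral {0..t} (\<lambda>s. s ^ Suc m * D s)"
    and D: "\<And>t. 0 \<le> t \<Longrightarrow> t < 1 \<Longrightarrow> D t = B t - 2 * real m * t / (1 - t\<^sup>2) * \<psi> t"
    and B0: "\<And>t. 0 \<le> t \<Longrightarrow> t < 1 \<Longrightarrow> B t \<ge> 0"
    and q: "0 < q" "q \<le> 1" and A: "A \<ge> 0" and r0: "1 / 2 \<le> r0" "r0 < 1"
    and BA: "\<And>t. r0 \<le> t \<Longrightarrow> t < 1 \<Longrightarrow> B t \<le> A * \<phi> t powr (1 - q) / (1 - t)\<^sup>2"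
  shows "\<exists>C\<ge>0. \<forall>r. r0 \<le> r \<longrightarrow> r < 1 \<longrightarrow> \<phi> r powr q \<le> C * ln (1 / (1 - r))"
proof -
  define P where "P t = t ^ Suc m * \<psi> t / (1 - t\<^sup>2) ^ m" for t
  have pos: "1 - t\<^sup>2 > 0" if "0 \<le> t" "t < 1" for t :: real
    using that by (simp add: power_less_one_iff abs_square_less_1)
  have dP: "(P has_real_derivative t ^ Suc m * B t / (1 - t\<^sup>2) ^ m) (at t)" if t: "0 < t" "t < 1" for t
  proof -
    have dpow: "((\<lambda>t. (1 - t\<^sup>2) ^ m) has_real_derivative - (2 * real m * t / (1 - t\<^sup>2)) * (1 - t\<^sup>2) ^ m) (at t)"
    proof (cases m)
      case (Suc k)
      have "((\<lambda>t::real. 1 - t\<^sup>2) has_real_derivative - 2 * t) (at t)"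
        by (auto intro!: derivative_eq_intros)
      moreover have "real m * (- 2 * t * (1 - t\<^sup>2) ^ (m - Suc 0)) =
          - (2 * real m * t / (1 - t\<^sup>2)) * (1 - t\<^sup>2) ^ m"
        using Suc pos[of t] t by simp
      ultimately show ?thesis using DERIV_power[of "\<lambda>t. 1 - t\<^sup>2" "- 2 * t" t UNIV m] by simp
    qed simp
    have "continuous_on {0..<1} (\<lambda>s. s ^ Suc m * D s)" by (intro continuous_intros Dc)
    from has_real_derivative_integral_0[OF this t]
    have "((\<lambda>t. t ^ Suc m * \<psi> t) has_real_derivative t ^ Suc m * D t) (at t)"
    proof (rule has_field_derivative_transform_within_open)
      show "open {0<..<1::real}" "t \<in> {0<..<1}" using t by auto
    qed (use flux in auto)
    from DERIV_divide[OF this dpow] have "(P has_real_derivative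
      (t ^ Suc m * D t * (1 - t\<^sup>2) ^ m - t ^ Suc m * \<psi> t * (- (2 * real m * t / (1 - t\<^sup>2)) * (1 - t\<^sup>2) ^ m)) /
        ((1 - t\<^sup>2) ^ m * (1 - t\<^sup>2) ^ m)) (at t)"
      unfolding P_def using pos[of t] t by simp
    \<comment> \<open>The first-order term of \<open>D\<close> cancels against the derivative of
      \<open>(1 - t\<^sup>2) ^ m\<close>; only the source \<open>B\<close> survives.\<close>
    also have "(t ^ Suc m * D t * (1 - t\<^sup>2) ^ m - t ^ Suc m * \<psi> t * (- (2 * real m * t / (1 - t\<^sup>2)) * (1 - t\<^sup>2) ^ m)) =
        (t ^ Suc m * B t) * (1 - t\<^sup>2) ^ m"
      using t by (simp add: D algebra_simps)
    finally show ?thesis using pos[of t] t by (simp add: mult.assoc)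
  qed
  have Pc: "continuous_on {0..r} P" if "r < 1" for r
  proof -
    have "1 - t\<^sup>2 \<noteq> 0" if "t \<in> {0..r}" for t using pos[of t] that \<open>r < 1\<close> by auto
    then show ?thesis unfolding P_def using that
      by (intro continuous_intros continuous_on_subset[OF \<psi>c]) auto
  qed
  \<comment> \<open>\<open>P 0 = 0\<close> by the factor \<open>t ^ Suc m\<close>, and
    \<open>P\<close> increases because \<open>B\<close> is nonnegative.\<close>
  have P0: "P r \<ge> 0" if r: "0 < r" "r < 1" for r
  proof -
    have "P 0 \<le> P r"
    proof (rule DERIV_nonneg_imp_increasing_open[of 0 r P])
      fix t assume t: "0 < t" "t < r"
      then have "t ^ Suc m * B t / (1 - t\<^sup>2) ^ m \<ge> 0"
        using B0[of t] pos[of t] r by simp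
      then show "\<exists>y. (P has_real_derivative y) (at t) \<and> y \<ge> 0" using dP[of t] t r by auto
    qed (use r Pc in auto)
    then show ?thesis by (simp add: P_def)
  qed
  have \<psi>P: "\<psi> r = P r * (1 - r\<^sup>2) ^ m / r ^ Suc m" if "0 < r" "r < 1" for r
    using pos[of r] that by (simp add: P_def field_simps)
  have \<psi>0: "\<psi> r \<ge> 0" if "0 < r" "r < 1" for r
    using \<psi>P[OF that] P0[OF that] pos[of r] that by simp
  have \<phi>mono: "\<phi> s \<le> \<phi> t" if "0 < s" "s \<le> t" "t < 1" for s t
    using that by (intro DERIV_nonneg_imp_nondecreasing[OF that(2)]) (force intro!: d\<phi> \<psi>0 exI)
  have P1: "P r \<le> (P r0 + A) * \<phi> r powr (1 - q) / (1 - r) ^ Suc m" if r: "r0 \<le> r" "r < 1" for r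
  proof -
    \<comment> \<open>Freezing the increasing function \<open>\<phi>\<close> at the right endpoint
      \<open>r\<close> makes \<open>c / (1 - t) ^ Suc m\<close> an explicit comparison function: its
      derivative \<open>Suc m * c / (1 - t) ^ (m + 2)\<close> dominates that of
      \<open>P\<close>.\<close>
    define c where "c = A * \<phi> r powr (1 - q)"
    have c0: "c \<ge> 0" using A by (simp add: c_def)
    have "c / (1 - r0) ^ Suc m - P r0 \<le> c / (1 - r) ^ Suc m - P r"
    proof (rule DERIV_nonneg_imp_nondecreasing[OF r(1)])
      fix t assume t: "r0 \<le> t" "t \<le> r"
      then have t01: "0 < t" "t < 1" using r0 r by auto
      have d: "((\<lambda>t. c / (1 - t) ^ Suc m - P t) has_real_derivative
          real (Suc m) * c / (1 - t) ^ (m + 2) - t ^ Suc m * B t / (1 - t\<^sup>2) ^ m) (at t)"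
      proof (rule DERIV_diff[OF _ dP[OF t01]])
        have "((\<lambda>t. inverse (1 - t)) has_real_derivative (inverse (1 - t))\<^sup>2) (at t)"
          using t01 by (auto intro!: derivative_eq_intros simp: power2_eq_square)
        from DERIV_cmult[OF DERIV_power[OF this, of "Suc m"], of c]
        show "((\<lambda>t. c / (1 - t) ^ Suc m) has_real_derivative real (Suc m) * c / (1 - t) ^ (m + 2)) (at t)"
          by (simp add: divide_inverse power_inverse power_add power2_eq_square mult_ac)
      qed
      have "t ^ Suc m * B t / (1 - t\<^sup>2) ^ m \<le> 1 * (c / (1 - t)\<^sup>2) / (1 - t) ^ m"
      proof (intro frac_le mult_mono power_mono)
        have "B t \<le> A * \<phi> t powr (1 - q) / (1 - t)\<^sup>2" using BA t t01 by simp
        also have "\<dots> \<le> c / (1 - t)\<^sup>2"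
          unfolding c_def using A \<phi>mono[of t r] \<phi>1[of t] t t01 r q
          by (intro divide_right_mono mult_left_mono powr_mono2) auto
        finally show "B t \<le> c / (1 - t)\<^sup>2" .
        show "t ^ Suc m \<le> 1" using t01 by (intro power_le_one) auto
        show "1 - t \<le> 1 - t\<^sup>2" using t01 by (simp add: power2_eq_square mult_left_le_one_le)
      qed (use t01 c0 B0 in auto)
      also have "\<dots> = 1 * c / (1 - t) ^ (m + 2)" by (simp add: power2_eq_square)
      also have "\<dots> \<le> real (Suc m) * c / (1 - t) ^ (m + 2)"
        using c0 t01 by (intro divide_right_mono mult_right_mono) auto
      finally show "\<exists>y. ((\<lambda>t. c / (1 - t) ^ Suc m - P t) has_real_derivative y) (at t) \<and> 0 \<le> y"
        using d by auto
    qed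
    moreover have "c / (1 - r0) ^ Suc m \<ge> 0" using c0 r0 by simp
    \<comment> \<open>\<open>\<phi> \<ge> 1\<close> lets the initial value \<open>P r0\<close> be
      absorbed into the main term.\<close>
    moreover have "P r0 * 1 \<le> P r0 * (\<phi> r powr (1 - q) / (1 - r) ^ Suc m)"
    proof (rule mult_left_mono)
      have "1 / 1 \<le> \<phi> r powr (1 - q) / (1 - r) ^ Suc m"
        using \<phi>1[of r] q r r0 by (intro frac_le ge_one_powr_ge_zero power_le_one) auto
      then show "1 \<le> \<phi> r powr (1 - q) / (1 - r) ^ Suc m" by simp
    qed (use P0 r0 in auto)
    ultimately have "P r \<le> P r0 * (\<phi> r powr (1 - q) / (1 - r) ^ Suc m) + c / (1 - r) ^ Suc m" by simp
    then show ?thesis by (simp add: c_def add_divide_distrib algebra_simps)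
  qed
  \<comment> \<open>\<open>2 ^ m\<close> comes from \<open>1 - r\<^sup>2 \<le> 2 * (1 - r)\<close>,
    and \<open>2 ^ Suc m\<close> from dividing by \<open>r ^ Suc m\<close> with
    \<open>r \<ge> 1 / 2\<close>.\<close>
  define C where "C = (P r0 + A) * 2 ^ m * 2 ^ Suc m"
  have C0: "C \<ge> 0" using P0[of r0] r0 A by (simp add: C_def)
  have \<psi>C: "\<psi> r \<le> C * \<phi> r powr (1 - q) / (1 - r)" if r: "r0 \<le> r" "r < 1" for r
  proof -
    have r01: "0 < r" "r < 1" using r r0 by auto
    have "\<psi> r = P r * (1 - r\<^sup>2) ^ m / r ^ Suc m" by (rule \<psi>P[OF r01])
    also have "\<dots> \<le> (P r0 + A) * \<phi> r powr (1 - q) / (1 - r) ^ Suc m * (2 * (1 - r)) ^ m / (1 / 2) ^ Suc m"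
    proof (intro frac_le mult_mono power_mono P1 r)
      have "1 - r\<^sup>2 = (1 + r) * (1 - r)" by (simp add: power2_eq_square algebra_simps)
      also have "\<dots> \<le> 2 * (1 - r)" using r01 by (intro mult_right_mono) auto
      finally show "1 - r\<^sup>2 \<le> 2 * (1 - r)" .
    qed (use r r01 r0 pos[of r] P0[of r0] A in auto)
    also have "\<dots> = C * \<phi> r powr (1 - q) / (1 - r)"
    proof -
      have "K * F / y ^ Suc m * (2 * y) ^ m / (1 / 2) ^ Suc m = K * 2 ^ m * 2 ^ Suc m * F / y"
        if "y > 0" for K F y :: real
        using that by (simp add: power_mult_distrib power_divide field_simps)
      from this[of "1 - r"] show ?thesis using r01 unfolding C_def by simp
    qed
    finally show ?thesis .
  qed
  have main: "\<phi> r powr q \<le> (C + \<phi> r0 powr q / ln 2) * ln (1 / (1 - r))" if r: "r0 \<le> r" "r < 1" for r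
  proof -
    \<comment> \<open>The factor \<open>\<phi> powr (q - 1)\<close> in the derivative of
      \<open>\<phi> powr q\<close> cancels the power of \<open>\<phi>\<close> in the bound on
      \<open>\<psi>\<close>, so the derivative of \<open>- C * ln (1 - t)\<close> dominates.\<close>
    have "- C * ln (1 - r0) - \<phi> r0 powr q \<le> - C * ln (1 - r) - \<phi> r powr q"
    proof (rule DERIV_nonneg_imp_nondecreasing[OF r(1)])
      fix t assume t: "r0 \<le> t" "t \<le> r"
      then have t01: "0 < t" "t < 1" using r0 r by auto
      have \<phi>t: "\<phi> t > 0" using \<phi>1[of t] t01 by simp
      have d: "((\<lambda>t. - C * ln (1 - t) - \<phi> t powr q) has_real_derivative C / (1 - t) - q * \<phi> t powr (q - 1) * \<psi> t) (at t)"
        using t01 \<phi>t by (auto intro!: derivative_eq_intros d\<phi>[OF t01] simp: powr_diff field_simps)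
      have "q * \<phi> t powr (q - 1) * \<psi> t \<le> 1 * \<phi> t powr (q - 1) * (C * \<phi> t powr (1 - q) / (1 - t))"
        using q t t01 r \<psi>C[of t] \<psi>0[of t] by (intro mult_mono) auto
      also have "\<dots> = C / (1 - t) * (\<phi> t powr (q - 1) * \<phi> t powr (1 - q))" by simp
      also have "\<phi> t powr (q - 1) * \<phi> t powr (1 - q) = 1" using \<phi>t by (simp flip: powr_add)
      finally show "\<exists>y. ((\<lambda>t. - C * ln (1 - t) - \<phi> t powr q) has_real_derivative y) (at t) \<and> 0 \<le> y"
        using d by auto
    qed
    moreover have "- C * ln (1 - r0) \<ge> 0" using C0 r0 by (simp add: mult_nonneg_nonpos)
    ultimately have "\<phi> r powr q \<le> C * ln (1 / (1 - r)) + \<phi> r0 powr q"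
      using r by (simp add: ln_div)
    \<comment> \<open>Since \<open>r \<ge> 1 / 2\<close>, the logarithm is at least
      \<open>ln 2\<close>, which absorbs the constant.\<close>
    also have "\<phi> r0 powr q = \<phi> r0 powr q / ln 2 * ln 2" by simp
    also have "\<dots> \<le> \<phi> r0 powr q / ln 2 * ln (1 / (1 - r))"
      using r r0 by (intro mult_left_mono) (auto simp: field_simps)
    finally show ?thesis by (simp add: algebra_simps)
  qed
  have "C + \<phi> r0 powr q / ln 2 \<ge> 0" using C0 by (intro add_nonneg_nonneg) auto
  with main show ?thesis by blast
qed

text \<open>Hoelder's inequality with weights \<open>1 - q\<close> and \<open>q\<close>, from
  Young's inequality for \<open>a / S\<close> and \<open>b / T\<close>. Positive upper bounds in
  place of the integrals avoid dividing by zero when \<open>b\<close> vanishes almost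
  everywhere.\<close>

lemma integral_powr_mult_le:
  fixes a b :: "'a \<Rightarrow> real"
  assumes a: "integrable M a" "\<And>x. x \<in> space M \<Longrightarrow> a x > 0"
    and b: "integrable M b" "\<And>x. x \<in> space M \<Longrightarrow> b x \<ge> 0"
    and ab: "integrable M (\<lambda>x. a x powr (1 - q) * b x powr q)"
    and q: "0 < q" "q \<le> 1"
    and S: "(\<integral>x. a x \<partial>M) \<le> S" "S > 0" and T: "(\<integral>x. b x \<partial>M) \<le> T" "T > 0"
  shows "(\<integral>x. a x powr (1 - q) * b x powr q \<partial>M) \<le> S powr (1 - q) * T powr q"
proof -
  define c where "c = S powr (1 - q) * T powr q"
  have c: "c > 0" using S T by (simp add: c_def)
  have "(\<integral>x. a x powr (1 - q) * b x powr q \<partial>M) \<le> (\<integral>x. c * ((1 - q) * (a x / S) + q * (b x / T)) \<partial>M)"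
  proof (rule integral_mono[OF ab])
    show "integrable M (\<lambda>x. c * ((1 - q) * (a x / S) + q * (b x / T)))"
      using a(1) b(1) by simp
    fix x assume x: "x \<in> space M"
    have "(a x / S) powr (1 - q) * (b x / T) powr q \<le> (1 - q) * (a x / S) + q * (b x / T)"
    proof (cases "b x = 0")
      case False
      then show ?thesis using a(2)[OF x] b(2)[OF x] S T q by (intro Youngs_inequality_0) auto
    qed (use a(2)[OF x] S q in auto)
    then have "c * ((a x / S) powr (1 - q) * (b x / T) powr q) \<le> c * ((1 - q) * (a x / S) + q * (b x / T))"
      using c by (intro mult_left_mono) auto
    also have "c * ((a x / S) powr (1 - q) * (b x / T) powr q) = a x powr (1 - q) * b x powr q"
      using a(2)[OF x] b(2)[OF x] S T by (simp add: c_def powr_divide)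
    finally show "a x powr (1 - q) * b x powr q \<le> c * ((1 - q) * (a x / S) + q * (b x / T))" .
  qed
  also have "\<dots> = c * ((1 - q) * ((\<integral>x. a x \<partial>M) / S) + q * ((\<integral>x. b x \<partial>M) / T))"
    using a(1) b(1) by simp
  also have "\<dots> \<le> c * ((1 - q) * 1 + q * 1)"
    using c S T q by (intro mult_left_mono add_mono) auto
  finally show ?thesis by (simp add: c_def)
qed

subsection \<open>Hyperbolic harmonic functions\<close>

lemma frechet_derivative_eq_sum_partial:
  assumes "f differentiable (at x)"
  shows "frechet_derivative f (at x) v = (\<Sum>b\<in>Basis. partial b f x * (v \<bullet> b))"
proof -
  interpret linear "frechet_derivative f (at x)" by (rule linear_frechet_derivative[OF assms])
  have "frechet_derivative f (at x) v = frechet_derivative f (at x) (\<Sum>b\<in>Basis. (v \<bullet> b) *\<^sub>R b)"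
    by (simp add: euclidean_representation)
  also have "\<dots> = (\<Sum>b\<in>Basis. (v \<bullet> b) *\<^sub>R partial b f x)"
    by (simp only: sum scale partial_def)
  finally show ?thesis by (simp add: mult.commute)
qed

lemma has_real_derivative_line:
  assumes "f differentiable (at (x + t *\<^sub>R v))"
  shows "((\<lambda>s. f (x + s *\<^sub>R v)) has_real_derivative
    (\<Sum>b\<in>Basis. partial b f (x + t *\<^sub>R v) * (v \<bullet> b))) (at t)"
proof -
  have "(f has_derivative frechet_derivative f (at (x + t *\<^sub>R v))) (at (x + t *\<^sub>R v))"
    using assms by (simp add: frechet_derivative_works)
  moreover have "((\<lambda>s. x + s *\<^sub>R v) has_derivative (\<lambda>h. h *\<^sub>R v)) (at t)"
    by (auto intro!: derivative_eq_intros)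
  ultimately have "((\<lambda>s. f (x + s *\<^sub>R v)) has_derivative (\<lambda>h. frechet_derivative f (at (x + t *\<^sub>R v)) (h *\<^sub>R v))) (at t)"
    by (rule has_derivative_compose[rotated])
  then have "((\<lambda>s. f (x + s *\<^sub>R v)) has_derivative
      (\<lambda>h. (\<Sum>b\<in>Basis. partial b f (x + t *\<^sub>R v) * (v \<bullet> b)) * h)) (at t)"
    by (simp add: frechet_derivative_eq_sum_partial[OF assms] sum_distrib_left sum_distrib_right mult_ac)
  then show ?thesis by (simp add: has_field_derivative_def)
qed

lemma has_real_derivative_partial:
  assumes "f differentiable (at x)" "b \<in> Basis"
  shows "((\<lambda>s. f (x + s *\<^sub>R b)) has_real_derivative partial b f x) (at 0)"
proof -
  have "(\<Sum>c\<in>Basis. partial c f x * (b \<bullet> c)) = (\<Sum>c\<in>Basis. if c = b then partial c f x else 0)"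
    using assms(2) by (intro sum.cong) (auto simp: inner_Basis)
  then have "(\<Sum>c\<in>Basis. partial c f x * (b \<bullet> c)) = partial b f x"
    using assms(2) by simp
  then show ?thesis using has_real_derivative_line[of f x 0 b] assms(1) by simp
qed

lemma inner_grad: "grad f x \<bullet> v = (\<Sum>b\<in>Basis. partial b f x * (v \<bullet> b))"
  unfolding grad_def inner_sum_left inner_scaleR_left by (simp add: inner_commute)

lemma norm_grad_power2: "(norm (grad f x))\<^sup>2 = (\<Sum>b\<in>Basis. (partial b f x)\<^sup>2)"
proof -
  have "grad f x \<bullet> b = partial b f x" if "b \<in> Basis" for b
    using that by (simp add: grad_def inner_sum_left_Basis)
  then show ?thesis
    unfolding power2_norm_eq_inner inner_grad by (simp add: power2_eq_square)
qed

locale hyperbolic =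
  fixes f :: "'a::euclidean_space \<Rightarrow> real" and p :: real
  assumes dim: "DIM('a) \<ge> 2" and p: "p \<ge> 2" and hh: "hyperbolic_harmonic f"
begin

lemma C2: "C2_on (ball 0 1) f"
  using hh by (simp add: hyperbolic_harmonic_def)

lemma diff_f: "x \<in> ball 0 1 \<Longrightarrow> f differentiable (at x)"
  using C2 by (auto simp: C2_on_def C1_on_def)

lemma diff_partial: "b \<in> Basis \<Longrightarrow> x \<in> ball 0 1 \<Longrightarrow> partial b f differentiable (at x)"
  using C2 by (auto simp: C2_on_def C1_on_def)

lemma cont_f: "continuous_on (ball 0 1) f"
  using diff_f by (simp add: differentiable_imp_continuous_within continuous_at_imp_continuous_on)

lemma cont_partial: "b \<in> Basis \<Longrightarrow> continuous_on (ball 0 1) (partial b f)"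
  using C2 by (auto simp: C2_on_def C1_on_def)

lemma cont_partial2: "b \<in> Basis \<Longrightarrow> continuous_on (ball 0 1) (partial b (partial b f))"
  using C2 by (auto simp: C2_on_def C1_on_def)

lemma cont_grad: "continuous_on (ball 0 1) (grad f)"
  unfolding grad_def[abs_def] by (intro continuous_intros cont_partial)

text \<open>The positive factor \<open>1 - (norm x)\<^sup>2\<close> is divided out. Second-order
  terms thereby become radial first-order ones, and these are again expressible through the
  flux.\<close>

lemma laplacian_eq:
  assumes "x \<in> ball 0 1"
  shows "laplacian f x = - 2 * (real DIM('a) - 2) / (1 - (norm x)\<^sup>2) * (grad f x \<bullet> x)"
proof -
  have "1 - (norm x)\<^sup>2 > 0" using assms by (simp add: abs_square_less_1)
  moreover from this have "(1 - (norm x)\<^sup>2) * laplacian f x + 2 * (real DIM('a) - 2) * (grad f x \<bullet> x) = 0"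
    using hh assms unfolding hyperbolic_harmonic_def hyperbolic_laplacian_def by (metis less_irrefl mult_eq_0_iff)
  ultimately show ?thesis by (simp add: field_simps)
qed

text \<open>The derivative of \<open>(1 + y\<^sup>2) powr (p / 2)\<close>;
  \<open>weight_deriv\<close> is the second derivative.\<close>

definition weight :: "real \<Rightarrow> real" where
  "weight y = p * y * (1 + y\<^sup>2) powr (p / 2 - 1)"

definition weight_deriv :: "real \<Rightarrow> real" where
  "weight_deriv y = p * (1 + y\<^sup>2) powr (p / 2 - 1) + p * (p - 2) * y\<^sup>2 * (1 + y\<^sup>2) powr (p / 2 - 2)"

lemma one_plus_power2_pos: "1 + (y::real)\<^sup>2 > 0"
  by (simp add: add_pos_nonneg)

lemma DERIV_weight: "(weight has_real_derivative weight_deriv y) (at y)"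
proof -
  have "((\<lambda>y. (1 + y\<^sup>2) powr (p / 2 - 1)) has_real_derivative
      (p / 2 - 1) * (1 + y\<^sup>2) powr (p / 2 - 2) * (2 * y)) (at y)"
    using one_plus_power2_pos[of y] by (auto intro!: derivative_eq_intros simp: powr_diff field_simps power2_eq_square)
  from DERIV_mult[OF DERIV_cmult_Id[of p] this] show ?thesis
    by (simp add: weight_def[abs_def] weight_deriv_def algebra_simps power2_eq_square)
qed

lemma DERIV_one_plus_power2_powr: "((\<lambda>y. (1 + y\<^sup>2) powr (p / 2)) has_real_derivative weight y) (at y)"
  using one_plus_power2_pos[of y] unfolding weight_def by (auto intro!: derivative_eq_intros simp: powr_diff field_simps)

text \<open>For \<open>p \<ge> 2\<close> both summands are nonnegative. This convexity is what makes
  the source term nonnegative.\<close>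

lemma weight_deriv_nonneg: "weight_deriv y \<ge> 0"
  using p by (simp add: weight_deriv_def)

text \<open>From \<open>y\<^sup>2 \<le> 1 + y\<^sup>2\<close> and
  \<open>p + p * (p - 2) = p * (p - 1)\<close>. The exponent \<open>p / 2 - 1\<close> is the one
  that Hoelder's inequality can match with \<open>(1 + y\<^sup>2) powr (p / 2)\<close>.\<close>

lemma weight_deriv_le: "weight_deriv y \<le> p * (p - 1) * (1 + y\<^sup>2) powr (p / 2 - 1)"
proof -
  have "(1 + y\<^sup>2) powr (p / 2 - 1) = (1 + y\<^sup>2) powr (p / 2 - 2) * (1 + y\<^sup>2) powr 1"
    unfolding powr_add[symmetric] by simp
  then have "(1 + y\<^sup>2) powr (p / 2 - 1) = (1 + y\<^sup>2) * (1 + y\<^sup>2) powr (p / 2 - 2)"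
    using one_plus_power2_pos[of y] by simp
  moreover have "y\<^sup>2 * (1 + y\<^sup>2) powr (p / 2 - 2) \<le> (1 + y\<^sup>2) * (1 + y\<^sup>2) powr (p / 2 - 2)"
    by (intro mult_right_mono) auto
  ultimately have "p * (p - 2) * (y\<^sup>2 * (1 + y\<^sup>2) powr (p / 2 - 2)) \<le> p * (p - 2) * (1 + y\<^sup>2) powr (p / 2 - 1)"
    using p by (intro mult_left_mono) auto
  then show ?thesis by (simp add: weight_deriv_def algebra_simps)
qed

lemma cont_weight: "continuous_on S weight"
  using DERIV_weight by (meson DERIV_continuous_on has_field_derivative_at_within)

lemma cont_weight_deriv: "continuous_on S weight_deriv"
  unfolding weight_deriv_def by (intro continuous_intros) (use one_plus_power2_pos in \<open>auto simp: less_imp_neq[symmetric]\<close>)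

definition weighted_grad :: "'a \<Rightarrow> 'a \<Rightarrow> real" where
  "weighted_grad b x = weight (f x) * partial b f x"

definition weighted_grad_deriv :: "'a \<Rightarrow> 'a \<Rightarrow> real" where
  "weighted_grad_deriv b x = weight_deriv (f x) * (partial b f x)\<^sup>2 + weight (f x) * partial b (partial b f) x"

text \<open>The field is the gradient of \<open>u = (1 + f\<^sup>2) powr (p / 2)\<close>, so
  \<open>flux\<close> and \<open>divergence\<close> become the spherical means of the radial
  derivative and of the Laplacian of \<open>u\<close>.\<close>

sublocale ball_field weighted_grad weighted_grad_deriv
proof
  fix b :: 'a assume b: "b \<in> Basis"
  show "((\<lambda>s. weighted_grad b (x + s *\<^sub>R b)) has_real_derivative weighted_grad_deriv b x) (at 0)" if x: "x \<in> ball 0 1" for x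
  proof -
    have "((\<lambda>s. weight (f (x + s *\<^sub>R b))) has_real_derivative weight_deriv (f x) * partial b f x) (at 0)"
      using DERIV_chain2[OF _ has_real_derivative_partial[OF diff_f[OF x] b], of weight] DERIV_weight by simp
    from DERIV_mult[OF this has_real_derivative_partial[OF diff_partial[OF b x] b]]
    show ?thesis by (simp add: weighted_grad_def weighted_grad_deriv_def power2_eq_square algebra_simps)
  qed
  show "continuous_on (ball 0 1) (weighted_grad b)"
    unfolding weighted_grad_def[abs_def]
    by (intro continuous_intros continuous_on_compose2[OF cont_weight cont_f] cont_partial b) auto
  show "continuous_on (ball 0 1) (weighted_grad_deriv b)"
    unfolding weighted_grad_deriv_def[abs_def]
    by (intro continuous_intros continuous_on_compose2[OF cont_weight cont_f] continuous_on_compose2[OF cont_weight_deriv cont_f]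
      cont_partial cont_partial2 b) auto
qed (rule dim)

section \<open>The spherical mean of \<open>u\<close> and its differential equation\<close>

definition power_mean :: "real \<Rightarrow> real" where
  "power_mean t = (\<integral>z. (1 + (f (t *\<^sub>R z))\<^sup>2) powr (p / 2) \<partial>sphere_measure)"

text \<open>The source of the differential equation: the part of the mean Laplacian of
  \<open>u\<close> that does not involve the Laplacian of \<open>f\<close>.\<close>

definition energy :: "real \<Rightarrow> real" where
  "energy t = (\<integral>z. weight_deriv (f (t *\<^sub>R z)) * (norm (grad f (t *\<^sub>R z)))\<^sup>2 \<partial>sphere_measure)"

lemma cont_sphere:
  assumes "0 \<le> t" "t < 1"
  shows "continuous_on (sphere 0 1) (\<lambda>z. f (t *\<^sub>R z))"
    "continuous_on (sphere 0 1) (\<lambda>z. grad f (t *\<^sub>R z))"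
    "b \<in> Basis \<Longrightarrow> continuous_on (sphere 0 1) (\<lambda>z. weighted_grad b (t *\<^sub>R z))"
    "continuous_on (sphere 0 1) (\<lambda>z. weight_deriv (f (t *\<^sub>R z)))"
    "continuous_on (sphere 0 1) (\<lambda>z. (1 + (f (t *\<^sub>R z))\<^sup>2) powr a)"
proof -
  show f: "continuous_on (sphere 0 1) (\<lambda>z. f (t *\<^sub>R z))"
    by (rule continuous_on_sphere_ball[OF cont_f assms])
  show "continuous_on (sphere 0 1) (\<lambda>z. grad f (t *\<^sub>R z))"
    by (rule continuous_on_sphere_ball[OF cont_grad assms])
  show "b \<in> Basis \<Longrightarrow> continuous_on (sphere 0 1) (\<lambda>z. weighted_grad b (t *\<^sub>R z))"
    by (rule continuous_on_sphere_ball[OF contV assms])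
  show "continuous_on (sphere 0 1) (\<lambda>z. weight_deriv (f (t *\<^sub>R z)))"
    by (rule continuous_on_compose2[OF cont_weight_deriv f]) auto
  have "1 + (f (t *\<^sub>R z))\<^sup>2 \<noteq> 0" for z using one_plus_power2_pos[of "f (t *\<^sub>R z)"] by linarith
  then show "continuous_on (sphere 0 1) (\<lambda>z. (1 + (f (t *\<^sub>R z))\<^sup>2) powr a)"
    by (intro continuous_intros f) auto
qed

lemma power_mean_ge_1:
  assumes "0 \<le> t" "t < 1"
  shows "power_mean t \<ge> 1"
proof -
  interpret prob_space "sphere_measure :: 'a measure" by (rule prob_space_sphere_measure)
  have "(\<integral>z. 1 \<partial>(sphere_measure :: 'a measure)) \<le> power_mean t"
    unfolding power_mean_def
    by (intro integral_mono integrable_sphere_measure cont_sphere assms)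
      (use p in \<open>auto intro!: ge_one_powr_ge_zero\<close>)
  then show ?thesis by (simp add: prob_space)
qed

text \<open>Along the ray through \<open>z\<close>, the derivative of \<open>u\<close> is the
  component of its gradient in direction \<open>z\<close>; this is integrated over the
  sphere.\<close>

lemma DERIV_power_mean:
  assumes t: "0 < t" "t < 1"
  shows "(power_mean has_real_derivative flux t) (at t)"
  unfolding power_mean_def[abs_def] flux_def
proof (rule has_real_derivative_integral_sphere[where a = 0 and b = 1])
  fix s z assume s: "0 < s" "s < (1::real)" and z: "z \<in> sphere (0::'a) 1"
  have "f differentiable (at (0 + s *\<^sub>R z))" using s z by (intro diff_f) auto
  from DERIV_chain2[OF DERIV_one_plus_power2_powr has_real_derivative_line[OF this]]
  show "((\<lambda>t. (1 + (f (t *\<^sub>R z))\<^sup>2) powr (p / 2)) has_real_derivative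
      (\<Sum>b\<in>Basis. weighted_grad b (s *\<^sub>R z) * (z \<bullet> b))) (at s)"
    by (simp add: weighted_grad_def sum_distrib_left mult_ac)
next
  have "continuous_on ({0<..<1} \<times> sphere 0 1) (\<lambda>(t, z). weighted_grad b (t *\<^sub>R z))" if "b \<in> Basis" for b
    by (rule continuous_on_subset[OF continuous_on_ball_polar[OF contV[OF that]]]) auto
  then show "continuous_on ({0<..<1} \<times> sphere 0 1) (\<lambda>(t, z). \<Sum>b\<in>Basis. weighted_grad b (t *\<^sub>R z) * (z \<bullet> b))"
    unfolding case_prod_unfold by (intro continuous_intros) auto
qed (use t cont_sphere in auto)

text \<open>By the chain rule the Laplacian of \<open>u\<close> is \<open>weight_deriv f\<close>
  times the squared gradient plus \<open>weight f\<close> times the Laplacian of \<open>f\<close>.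
  At \<open>t *\<^sub>R z\<close> the latter is \<open>- k\<close> times the radial derivative of
  \<open>f\<close>, with \<open>k\<close> constant on the sphere.\<close>

lemma divergence_eq:
  assumes t: "0 \<le> t" "t < 1"
  shows "divergence t = energy t - 2 * real (DIM('a) - 2) * t / (1 - t\<^sup>2) * flux t"
proof -
  define k where "k = 2 * real (DIM('a) - 2) * t / (1 - t\<^sup>2)"
  have "divergence t = (\<integral>z. weight_deriv (f (t *\<^sub>R z)) * (norm (grad f (t *\<^sub>R z)))\<^sup>2 -
      k * (\<Sum>b\<in>Basis. weighted_grad b (t *\<^sub>R z) * (z \<bullet> b)) \<partial>sphere_measure)"
    unfolding divergence_def
  proof (rule Bochner_Integration.integral_cong[OF refl])
    fix z :: 'a assume "z \<in> space sphere_measure"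
    then have z: "norm z = 1" by (simp add: space_sphere_measure)
    have "laplacian f (t *\<^sub>R z) = - k * (grad f (t *\<^sub>R z) \<bullet> z)"
      using t z dim abs_square_less_1[of t] by (subst laplacian_eq) (auto simp: k_def of_nat_diff field_simps)
    then have "weight (f (t *\<^sub>R z)) * laplacian f (t *\<^sub>R z) = - k * (\<Sum>b\<in>Basis. weighted_grad b (t *\<^sub>R z) * (z \<bullet> b))"
      by (simp add: inner_grad weighted_grad_def sum_distrib_left mult_ac)
    moreover have "(\<Sum>b\<in>Basis. weighted_grad_deriv b (t *\<^sub>R z)) = weight_deriv (f (t *\<^sub>R z)) * (norm (grad f (t *\<^sub>R z)))\<^sup>2 +
        weight (f (t *\<^sub>R z)) * laplacian f (t *\<^sub>R z)"
      by (simp add: weighted_grad_deriv_def norm_grad_power2 laplacian_def sum.distrib sum_distrib_left)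
    ultimately show "(\<Sum>b\<in>Basis. weighted_grad_deriv b (t *\<^sub>R z)) = weight_deriv (f (t *\<^sub>R z)) * (norm (grad f (t *\<^sub>R z)))\<^sup>2 -
        k * (\<Sum>b\<in>Basis. weighted_grad b (t *\<^sub>R z) * (z \<bullet> b))" by simp
  qed
  also have "\<dots> = energy t - k * flux t"
    unfolding energy_def flux_def
    by (subst Bochner_Integration.integral_diff)
      (auto intro!: integrable_sphere_measure continuous_on_mult continuous_on_power continuous_on_norm
        continuous_on_sum continuous_on_inner cont_sphere t)
  finally show ?thesis by (simp add: k_def)
qed

text \<open>Hoelder's inequality with \<open>q = 2 / p\<close> for
  \<open>(1 + f\<^sup>2) powr (p / 2)\<close> and the \<open>p\<close>-th power of the gradient
  norm: raised to \<open>1 - q\<close> and \<open>q\<close>, they give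
  \<open>(1 + f\<^sup>2) powr (p / 2 - 1)\<close> and the squared gradient norm.\<close>

lemma energy_le:
  assumes t: "0 \<le> t" "t < 1" and C: "C > 0"
    and M: "integral_mean p t (grad f) \<le> C / (1 - t)"
  shows "energy t \<le> p * (p - 1) * C\<^sup>2 * power_mean t powr (1 - 2 / p) / (1 - t)\<^sup>2"
proof -
  define a where "a z = (1 + (f (t *\<^sub>R z))\<^sup>2) powr (p / 2)" for z
  define b where "b z = norm (grad f (t *\<^sub>R z)) powr p" for z
  have apos: "a z > 0" and b0: "b z \<ge> 0" for z
    using one_plus_power2_pos[of "f (t *\<^sub>R z)"] by (auto simp: a_def b_def)
  have "p / 2 * (1 - 2 / p) = p / 2 - 1" using p by (simp add: field_simps)
  then have aq: "a z powr (1 - 2 / p) = (1 + (f (t *\<^sub>R z))\<^sup>2) powr (p / 2 - 1)" for z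
    by (simp only: a_def powr_powr)
  have bq: "b z powr (2 / p) = (norm (grad f (t *\<^sub>R z)))\<^sup>2" for z
    using p by (simp add: b_def powr_powr)
  have inta: "integrable sphere_measure a"
    unfolding a_def by (intro integrable_sphere_measure cont_sphere t)
  have intb: "integrable sphere_measure b"
    unfolding b_def using p
    by (intro integrable_sphere_measure continuous_on_powr' continuous_on_norm cont_sphere t) auto
  have intab: "integrable sphere_measure (\<lambda>z. a z powr (1 - 2 / p) * b z powr (2 / p))"
    unfolding aq bq
    by (intro integrable_sphere_measure continuous_on_mult continuous_on_power continuous_on_norm cont_sphere t)
  have "energy t \<le> (\<integral>z. p * (p - 1) * (a z powr (1 - 2 / p) * b z powr (2 / p)) \<partial>sphere_measure)"
    unfolding energy_def
  proof (rule integral_mono)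
    show "integrable sphere_measure (\<lambda>z. weight_deriv (f (t *\<^sub>R z)) * (norm (grad f (t *\<^sub>R z)))\<^sup>2)"
      by (intro integrable_sphere_measure continuous_on_mult continuous_on_power continuous_on_norm cont_sphere t)
    show "integrable sphere_measure (\<lambda>z. p * (p - 1) * (a z powr (1 - 2 / p) * b z powr (2 / p)))"
      using intab by simp
    show "weight_deriv (f (t *\<^sub>R z)) * (norm (grad f (t *\<^sub>R z)))\<^sup>2 \<le>
        p * (p - 1) * (a z powr (1 - 2 / p) * b z powr (2 / p))" for z
      unfolding aq bq mult.assoc[symmetric] by (intro mult_right_mono weight_deriv_le) auto
  qed
  also have "\<dots> = p * (p - 1) * (\<integral>z. a z powr (1 - 2 / p) * b z powr (2 / p) \<partial>sphere_measure)"
    by simp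
  also have "\<dots> \<le> p * (p - 1) * (power_mean t powr (1 - 2 / p) * ((C / (1 - t)) powr p) powr (2 / p))"
  proof (intro mult_left_mono integral_powr_mult_le inta intb intab apos b0)
    show "(\<integral>z. a z \<partial>sphere_measure) \<le> power_mean t" by (simp add: power_mean_def a_def)
    show "power_mean t > 0" using power_mean_ge_1[OF t] by simp
    have "0 \<le> (\<integral>z. b z \<partial>sphere_measure)" by (intro integral_nonneg_AE AE_I2 b0)
    then have "(\<integral>z. b z \<partial>sphere_measure) = integral_mean p t (grad f) powr p"
      using p by (simp add: integral_mean_def b_def powr_powr)
    also have "\<dots> \<le> (C / (1 - t)) powr p"
      using M p by (intro powr_mono2) (auto simp: integral_mean_def)
    finally show "(\<integral>z. b z \<partial>sphere_measure) \<le> (C / (1 - t)) powr p" .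
  qed (use p C t in auto)
  also have "((C / (1 - t)) powr p) powr (2 / p) = C\<^sup>2 / (1 - t)\<^sup>2"
    using p C t by (simp add: powr_powr power_divide)
  finally show ?thesis by (simp add: mult_ac)
qed

text \<open>Since \<open>f\<^sup>2 \<le> 1 + f\<^sup>2\<close>, the mean is at most
  \<open>power_mean t powr (1 / p)\<close>. The iterated power isolates the quantity that grows
  logarithmically and shows the final exponent \<open>1 / 2\<close>.\<close>

lemma integral_mean_le:
  assumes t: "0 \<le> t" "t < 1"
  shows "integral_mean p t f \<le> (power_mean t powr (2 / p)) powr (1 / 2)"
proof -
  have "(\<integral>z. norm (f (t *\<^sub>R z)) powr p \<partial>sphere_measure) \<le> power_mean t"
    unfolding power_mean_def
  proof (rule integral_mono)
    show "integrable sphere_measure (\<lambda>z. norm (f (t *\<^sub>R z)) powr p)"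
      using p by (intro integrable_sphere_measure continuous_on_powr' continuous_on_norm cont_sphere t) auto
    show "integrable sphere_measure (\<lambda>z. (1 + (f (t *\<^sub>R z))\<^sup>2) powr (p / 2))"
      by (intro integrable_sphere_measure cont_sphere t)
    fix z :: 'a
    have "norm (f (t *\<^sub>R z)) powr p = ((f (t *\<^sub>R z))\<^sup>2) powr (p / 2)"
    proof (cases "f (t *\<^sub>R z) = 0")
      case False
      then have "(f (t *\<^sub>R z))\<^sup>2 = \<bar>f (t *\<^sub>R z)\<bar> powr 2" by simp
      then show ?thesis by (simp only: powr_powr) simp
    qed simp
    also have "\<dots> \<le> (1 + (f (t *\<^sub>R z))\<^sup>2) powr (p / 2)"
      using p by (intro powr_mono2) auto
    finally show "norm (f (t *\<^sub>R z)) powr p \<le> (1 + (f (t *\<^sub>R z))\<^sup>2) powr (p / 2)" .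
  qed
  then have "integral_mean p t f \<le> power_mean t powr (1 / p)"
    unfolding integral_mean_def using p by (intro powr_mono2 integral_nonneg_AE AE_I2) auto
  then show ?thesis using p by (simp add: powr_powr)
qed

theorem integral_mean_growth:
  assumes "(\<lambda>r. integral_mean p r (grad f)) \<in> O[at_left 1](\<lambda>r. 1 / (1 - r))"
  shows "(\<lambda>r. integral_mean p r f) \<in> O[at_left 1](\<lambda>r. (ln (1 / (1 - r))) powr (1 / 2))"
proof -
  obtain C where C: "C > 0"
    and "\<forall>\<^sub>F r in at_left 1. norm (integral_mean p r (grad f)) \<le> C * norm (1 / (1 - r))"
    using assms by (rule landau_o.bigE)
  then obtain r1 where r1: "r1 < 1" "\<And>r. r1 < r \<Longrightarrow> r < 1 \<Longrightarrow>
      norm (integral_mean p r (grad f)) \<le> C * norm (1 / (1 - r))"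
    unfolding eventually_at_left_field by blast
  \<comment> \<open>The midpoint lies strictly between \<open>r1\<close> and \<open>1\<close>, so
    the gradient bound also holds at \<open>r0\<close>; \<open>1 / 2\<close> keeps powers of
    \<open>r\<close> and the logarithm away from zero.\<close>
  define r0 where "r0 = max (1 / 2) ((r1 + 1) / 2)"
  have r0: "1 / 2 \<le> r0" "r0 < 1" "r1 < r0" using r1(1) by (auto simp: r0_def max_def)
  have M: "integral_mean p r (grad f) \<le> C / (1 - r)" if "r0 \<le> r" "r < 1" for r
    using r1(2)[of r] that r0 by simp
  have dim': "DIM('a) - 1 = Suc (DIM('a) - 2)" using dim by simp
  have "\<exists>K\<ge>0. \<forall>r. r0 \<le> r \<longrightarrow> r < 1 \<longrightarrow> power_mean r powr (2 / p) \<le> K * ln (1 / (1 - r))"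
  proof (rule log_growth[where \<psi> = flux and D = divergence and B = energy and m = "DIM('a) - 2"
        and A = "p * (p - 1) * C\<^sup>2"])
    fix t :: real
    show "energy t \<ge> 0" unfolding energy_def
      by (intro integral_nonneg_AE AE_I2 mult_nonneg_nonneg weight_deriv_nonneg) auto
    show "energy t \<le> p * (p - 1) * C\<^sup>2 * power_mean t powr (1 - 2 / p) / (1 - t)\<^sup>2" if "r0 \<le> t" "t < 1"
      using that r0 by (intro energy_le C M) auto
    show "t ^ Suc (DIM('a) - 2) * flux t = integral {0..t} (\<lambda>s. s ^ Suc (DIM('a) - 2) * divergence s)"
      if "0 \<le> t" "t < 1"
      using flux_eq_integral_divergence[OF that] by (simp only: dim')
  qed (use p r0 power_mean_ge_1 DERIV_power_mean continuous_on_flux continuous_on_divergence divergence_eq in auto)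
  then obtain K where K: "K \<ge> 0" "\<And>r. r0 \<le> r \<Longrightarrow> r < 1 \<Longrightarrow> power_mean r powr (2 / p) \<le> K * ln (1 / (1 - r))"
    by blast
  show ?thesis
  proof (rule bigoI)
    show "\<forall>\<^sub>F r in at_left 1. norm (integral_mean p r f) \<le> K powr (1 / 2) * norm (ln (1 / (1 - r)) powr (1 / 2))"
      unfolding eventually_at_left_field
    proof (intro exI conjI allI impI)
      fix r assume r: "r0 < r" "r < (1::real)"
      have "integral_mean p r f \<le> (power_mean r powr (2 / p)) powr (1 / 2)"
        using r r0 by (intro integral_mean_le) auto
      also have "\<dots> \<le> (K * ln (1 / (1 - r))) powr (1 / 2)"
        using K(2)[of r] r by (intro powr_mono2) auto
      also have "\<dots> = K powr (1 / 2) * ln (1 / (1 - r)) powr (1 / 2)"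
        by (rule powr_mult)
      finally show "norm (integral_mean p r f) \<le> K powr (1 / 2) * norm (ln (1 / (1 - r)) powr (1 / 2))"
        by (simp add: integral_mean_def)
    qed (use r0 in auto)
  qed
qed

end

theorem corollary1p7:
  fixes f :: "real ^ 'n \<Rightarrow> real" and p :: real
  assumes "CARD('n) \<ge> 2" and "p \<ge> 2"
    and "hyperbolic_harmonic f"
    and "(\<lambda>r. integral_mean p r (grad f)) \<in> O[at_left 1](\<lambda>r. 1 / (1 - r))"
  shows "(\<lambda>r. integral_mean p r f) \<in> O[at_left 1](\<lambda>r. (ln (1 / (1 - r))) powr (1 / 2))"
proof -
  interpret hyperbolic f p by unfold_locales (use assms in simp_all)
  show ?thesis using assms(4) by (rule integral_mean_growth)
qed

end
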